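(* Let $\lambda>0$, $\sigma>0$, $0<\alpha_2\le 1$. Let $\{N_{1,\alpha_2}(t_1,t_2),\ (t_1,t_2)\in\mathbb{R}^2_+\}$ be the fractional Poisson random field with parameter $\lambda$ and indices $\alpha_1=1$ and $\alpha_2$, let $Y_1,Y_2,\dots$ be iid exponential random variables with parameter (rate) $\sigma$, independent of this field, and let $\mathscr{Y}_{1,\alpha_2}(t_1,t_2)=\sum_{j=1}^{N_{1,\alpha_2}(t_1,t_2)}Y_j$. Then, for all $(t_1,t_2)\in\mathbb{R}^2_+$ and $y\in\mathbb{R}$, $$\mathrm{Pr}\{\mathscr{Y}_{1,\alpha_2}(t_1,t_2)\leq y\}=E_{\alpha_2,1}(-\lambda t_1t_2^{\alpha_2})\mathbf{1}_{[0,\infty)}(y)+\int_{-\infty}^{y}f_{\mathscr{Y}_{1,\alpha_2}}(x,t_1,t_2)\,\mathrm{d}x,$$ where $f_{\mathscr{Y}_{1,\alpha_2}}(y,t_1,t_2)=0$ for $y<0$ and, for $y>0$, $$f_{\mathscr{Y}_{1,\alpha_2}}(y,t_1,t_2)=\frac{e^{-\sigma y}}{y}\sum_{n=1}^{\infty}\frac{(\lambda\sigma t_1t_2^{\alpha_2}y)^n}{(n-1)!}E_{\alpha_2,n\alpha_2+1}^{n+1}(-\lambda t_1t_2^{\alpha_2}).$$ For $y>0$ the function $f_{\mathscr{Y}_{1,\alpha_2}}$ solves $$\sigma\frac{\partial^{\alpha_2}}{\partial t_2^{\alpha_2}}f_{\mathscr{Y}_{1,\alpha_2}}(y,t_1,t_2)=-\bigg(\lambda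 t_1+\frac{\partial^{\alpha_2}}{\partial t_2^{\alpha_2}}\bigg)\frac{\partial}{\partial y}f_{\mathscr{Y}_{1,\alpha_2}}(y,t_1,t_2),\quad t_1\ge0,$$ with $f_{\mathscr{Y}_{1,\alpha_2}}(y,t_1,0)=0$, where $\frac{\partial^{\alpha_2}}{\partial t_2^{\alpha_2}}$ is the Caputo fractional derivative. Also, $$\int_{0}^{\infty}f_{\mathscr{Y}_{1,\alpha_2}}(y,t_1,t_2)\,\mathrm{d}y=1-E_{\alpha_2,1}(-\lambda t_1t_2^{\alpha_2}).$$
   Context: $\mathbb{R}_+=[0,\infty)$. An empty sum is $0$. Fractional Poisson random field (FPRF) with parameter $\lambda>0$ and indices $0<\alpha_1,\alpha_2\le1$: a nonnegative-integer-valued random field $\{N_{\alpha_1,\alpha_2}(t_1,t_2)\}$ on $\mathbb{R}^2_+$ whose one-point distribution $p_{\alpha_1,\alpha_2}(n,t_1,t_2)=\mathrm{Pr}\{N_{\alpha_1,\alpha_2}(t_1,t_2)=n\}$, $n\ge0$, solves $$\frac{\partial^{\alpha_1+\alpha_2}}{\partial t_2^{\alpha_2}\partial t_1^{\alpha_1}}p_{\alpha_1,\alpha_2}(n,t_1,t_2)=(n+1)\lambda p_{\alpha_1,\alpha_2}(n+1,t_1,t_2)-(2n+1)\lambda p_{\alpha_1,\alpha_2}(n,t_1,t_2)+n\lambda p_{\alpha_1,\alpha_2}(n-1,t_1,t_2)$$ (Caputo derivatives) with $p_{\alpha_1,\alpha_2}(0,0,0)=p_{\alpha_1,\alpha_2}(0,t_1,0)=p_{\alpha_1,\alpha_2}(0,0,t_2)=1$.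 It is known (and may be used) that $$p_{\alpha_1,\alpha_2}(n,t_1,t_2)=\sum_{k=n}^{\infty}\frac{(-1)^{k-n}(k)_{k-n}(k)_n(\lambda t_1^{\alpha_1}t_2^{\alpha_2})^k}{\Gamma(k\alpha_1+1)\Gamma(k\alpha_2+1)},\quad (k)_n=k(k-1)\cdots(k-n+1),\ (k)_0=1;$$ here it is applied with $\alpha_1=1$. Three-parameter Mittag-Leffler function: $E_{\alpha,\beta}^{\gamma}(x)=\sum_{k=0}^\infty\frac{\gamma^{(k)}x^k}{\Gamma(\alpha k+\beta)k!}$, $\gamma^{(k)}=\gamma(\gamma+1)\cdots(\gamma+k-1)$, and $E_{\alpha,\beta}=E_{\alpha,\beta}^1$. Caputo derivative of order $\alpha\in(0,1]$: $\frac{\mathrm{d}^\alpha}{\mathrm{d}t^\alpha}g(t)=\frac{1}{\Gamma(1-\alpha)}\int_0^t\frac{g'(s)}{(t-s)^\alpha}\,\mathrm{d}s$ for $0<\alpha<1$, and $g'(t)$ for $\alpha=1$. *)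

theory Defs
  imports "HOL-Probability.Probability"
begin

text \<open>Three-parameter Mittag-Leffler function; the arguments are in the order
  \<open>\<alpha>\<close>, \<open>\<beta>\<close> (lower indices), \<open>\<gamma>\<close> (upper index).\<close>

definition mittag_leffler3 :: "real \<Rightarrow> real \<Rightarrow> real \<Rightarrow> real \<Rightarrow> real" where
  "mittag_leffler3 \<alpha> \<beta> \<gamma> x =
     (\<Sum>k. pochhammer \<gamma> k * x ^ k / (Gamma (\<alpha> * real k + \<beta>) * fact k))"

definition mittag_leffler :: "real \<Rightarrow> real \<Rightarrow> real \<Rightarrow> real" where
  "mittag_leffler \<alpha> \<beta> x = mittag_leffler3 \<alpha> \<beta> 1 x"

text \<open>\<open>has_caputo_derivative \<alpha> g D t\<close>: the Caputo derivative of order \<open>\<alpha> \<in> (0,1]\<close> of \<open>g\<close> exists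
  at \<open>t \<ge> 0\<close> and equals \<open>D\<close>.  The derivative \<open>g'\<close> does not see a jump of \<open>g\<close> at \<open>0\<close>, so an
  initial condition at \<open>0\<close> would be void without continuity up to \<open>0\<close>.  Together with the
  integrability of \<open>g'(s) (t - s)\<^sup>-\<^sup>\<alpha>\<close>, it makes \<open>g\<close> absolutely continuous on \<open>[0,t]\<close>,
  the usual domain of the operator.\<close>

definition has_caputo_derivative :: "real \<Rightarrow> (real \<Rightarrow> real) \<Rightarrow> real \<Rightarrow> real \<Rightarrow> bool" where
  "has_caputo_derivative \<alpha> g D t \<longleftrightarrow>
     continuous_on {0..t} g \<and>
     (if \<alpha> = 1 then (g has_real_derivative D) (at t within {0..})
      else (\<forall>s\<in>{0<..<t}. g differentiable (at s)) \<and>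
           set_integrable lborel {0<..<t} (\<lambda>s. deriv g s / (t - s) powr \<alpha>) \<and>
           D = 1 / Gamma (1 - \<alpha>) * (LBINT s:{0<..<t}. deriv g s / (t - s) powr \<alpha>))"

definition one_point_prob :: "'a measure \<Rightarrow> (real \<Rightarrow> real \<Rightarrow> 'a \<Rightarrow> nat) \<Rightarrow> nat \<Rightarrow> real \<Rightarrow> real \<Rightarrow> real" where
  "one_point_prob M N n t1 t2 = measure M {\<omega> \<in> space M. N t1 t2 \<omega> = n}"

text \<open>Fractional Poisson random field on \<open>[0,\<infinity>)\<^sup>2\<close>.  In the mixed derivative the Caputo derivative
  in \<open>t1\<close> (the function \<open>q\<close> of the second variable) is taken first.  For \<open>n = 0\<close> the
  term with \<open>n - 1\<close> has coefficient \<open>0\<close>.\<close>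

definition fractional_poisson_field ::
    "'a measure \<Rightarrow> real \<Rightarrow> real \<Rightarrow> real \<Rightarrow> (real \<Rightarrow> real \<Rightarrow> 'a \<Rightarrow> nat) \<Rightarrow> bool" where
  "fractional_poisson_field M lam \<alpha>1 \<alpha>2 N \<longleftrightarrow>
     (\<forall>t1\<ge>0. \<forall>t2\<ge>0. N t1 t2 \<in> measurable M (count_space UNIV)) \<and>
     (\<forall>n. \<forall>t1>0. \<forall>t2>0. \<exists>q.
        (\<forall>s\<ge>0. has_caputo_derivative \<alpha>1 (\<lambda>r. one_point_prob M N n r s) (q s) t1) \<and>
        has_caputo_derivative \<alpha>2 q
          (real (n + 1) * lam * one_point_prob M N (n + 1) t1 t2
           - real (2 * n + 1) * lam * one_point_prob M N n t1 t2
           + real n * lam * one_point_prob M N (n - 1) t1 t2) t2) \<and>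
     one_point_prob M N 0 0 0 = 1 \<and>
     (\<forall>t1\<ge>0. one_point_prob M N 0 t1 0 = 1) \<and>
     (\<forall>t2\<ge>0. one_point_prob M N 0 0 t2 = 1)"

definition compound_field ::
    "(real \<Rightarrow> real \<Rightarrow> 'a \<Rightarrow> nat) \<Rightarrow> (nat \<Rightarrow> 'a \<Rightarrow> real) \<Rightarrow> real \<Rightarrow> real \<Rightarrow> 'a \<Rightarrow> real" where
  "compound_field N Y t1 t2 \<omega> = (\<Sum>j=1..N t1 t2 \<omega>. Y j \<omega>)"

text \<open>The summation index is shifted: \<open>n\<close> here stands for \<open>n - 1\<close> in the usual sum over \<open>n \<ge> 1\<close>.\<close>

definition density_term ::
    "real \<Rightarrow> real \<Rightarrow> real \<Rightarrow> real \<Rightarrow> real \<Rightarrow> real \<Rightarrow> nat \<Rightarrow> real" where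
  "density_term lam \<sigma> \<alpha>2 y t1 t2 n =
     (lam * \<sigma> * t1 * t2 powr \<alpha>2 * y) ^ (n + 1) / fact n *
     mittag_leffler3 \<alpha>2 (real (n + 1) * \<alpha>2 + 1) (real (n + 1) + 1) (- lam * t1 * t2 powr \<alpha>2)"

text \<open>The value at \<open>y = 0\<close> is immaterial and set to \<open>0\<close>.\<close>

definition compound_density ::
    "real \<Rightarrow> real \<Rightarrow> real \<Rightarrow> real \<Rightarrow> real \<Rightarrow> real \<Rightarrow> real" where
  "compound_density lam \<sigma> \<alpha>2 y t1 t2 =
     (if y > 0 then exp (- \<sigma> * y) / y * (\<Sum>n. density_term lam \<sigma> \<alpha>2 y t1 t2 n) else 0)"

end

theory Submission
  imports Defs
begin

text \<open>Put \<open>x = \<lambda> t\<^sub>1 t\<^sub>2\<^sup>\<alpha>\<close>. The equation of the field is turned into a double integral equation, in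
  \<open>t\<^sub>1\<close> by the mean value theorem and in \<open>t\<^sub>2\<close> by inverting the Caputo derivative with Fubini and the
  Beta integral. Iterating it from the a priori bound \<open>0 \<le> p \<le> 1\<close> gives
  \<open>p n = (\<Sum>k. (-1)\<^bsup>k+n\<^esup> (k choose n) x\<^sup>k / \<Gamma>(\<alpha> k + 1))\<close>, so the one-point law is unique.
  The compound field is then a mixture of Erlang laws. Its density is expanded in powers of \<open>x\<close>; the
  coefficients \<open>a\<^sub>k(y)\<close> satisfy \<open>\<sigma> a\<^sub>k\<^sub>+\<^sub>1 + a\<^sub>k\<^sub>+\<^sub>1' = - a\<^sub>k'\<close> by Pascal's rule, and the Caputo derivative
  shifts the index of such a series, which yields the differential equation.\<close>

section \<open>Gamma and Beta functions\<close>

text \<open>The equation for p n involves p (n + 1), so the system cannot be solved upwards in n.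
  Its coefficients grow linearly in n, so the right-hand side is an unbounded operator and a
  contraction argument on bounded sequences fails. What rescues the iteration is a count of factors.
  K rounds cost at most 4^K (n + 1)(n + 2)...(n + K) = 4^K K! C(n + K, K). The integrations in t1
  return 1/K!, those in t2 return 1/Gamma(a K + 1). The factorials cancel, the binomial is at most
  2^(n + K), and Gamma(a K + 1) outgrows every geometric sequence for every a > 0.

  The price is a factor 2^n in the error. It is harmless after mixing, because the Erlang density of
  index n carries 1/n!. This allows the sum over n to be exchanged for an expansion in x, where t2
  occurs only through the powers t2^(a k), on which the Caputo derivative acts explicitly.\<close>

lemma Gamma_ge_powr:
  assumes "x \<ge> (0::real)" "A > 0"
  shows "A powr x * exp (- A) \<le> Gamma (x + 1)"
proof -
  have G: "((\<lambda>t. t powr x / exp t) has_integral Gamma (x + 1)) {0..}"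
    using Gamma_integral_real[of "x + 1"] assms by simp
  have E: "((\<lambda>t. A powr x * exp (- t)) has_integral A powr x * exp (- A)) {A..}"
    using has_integral_mult_right[OF has_integral_exp_minus_to_infinity[of 1 A], of "A powr x"] by simp
  \<comment> \<open>Only the tail t \<ge> A of Euler's integral is kept, where t^x is at least
    A^x.\<close>
  have "((\<lambda>t. if t \<in> {A..} then A powr x * exp (- t) else 0) has_integral A powr x * exp (- A)) {0..}"
    by (subst has_integral_restrict) (use E assms in auto)
  then show ?thesis
  proof (rule has_integral_le[OF _ G])
    fix t :: real
    have "A powr x * exp (- t) \<le> t powr x / exp t" if "A \<le> t"
      using powr_mono2[of x A t] that assms by (simp add: exp_minus divide_inverse)
    then show "(if t \<in> {A..} then A powr x * exp (- t) else 0) \<le> t powr x / exp t" by simp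
  qed
qed

lemma power_div_Gamma_le_geometric:
  assumes "a > (0::real)" "B \<ge> 0"
  obtains D where "D > 0" "\<And>k. B ^ k / Gamma (a * real k + 1) \<le> D * (1/2) ^ k"
proof -
  \<comment> \<open>Chosen so that \<open>A powr a = 2 * B + 1\<close>: the lower bound for Gamma
    then beats \<open>(2 * B) ^ k\<close> up to the factor exp(-A). The summand 1 keeps
    \<open>A\<close> positive when \<open>B = 0\<close>.\<close>
  define A where "A = (2 * B + 1) powr (1 / a)"
  have A: "A > 0" "A powr a = 2 * B + 1" using assms by (simp_all add: A_def powr_powr)
  have "B ^ k / Gamma (a * real k + 1) \<le> exp A * (1/2) ^ k" for k
  proof -
    have "A powr (a * real k) = (2 * B + 1) ^ k"
      using assms A by (simp add: powr_powr[symmetric] powr_realpow)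
    then have "(2 * B + 1) ^ k * exp (- A) \<le> Gamma (a * real k + 1)"
      using Gamma_ge_powr[of "a * real k" A] assms A(1) by simp
    moreover have "(2 * B) ^ k \<le> (2 * B + 1) ^ k" using assms by (intro power_mono) auto
    ultimately have "(2 * B) ^ k * exp (- A) \<le> Gamma (a * real k + 1)"
      by (meson exp_ge_zero mult_right_mono order_trans)
    moreover have "Gamma (a * real k + 1) > 0" using assms by (intro Gamma_real_pos) (simp add: add_nonneg_pos)
    ultimately show ?thesis
      by (simp add: divide_simps power_mult_distrib exp_minus mult_ac)
  qed
  then show ?thesis using that[of "exp A"] by simp
qed

lemma summable_power_div_Gamma:
  assumes "a > (0::real)"
  shows "summable (\<lambda>k. B ^ k / Gamma (a * real k + 1))"
proof -
  obtain D where D: "\<And>k. \<bar>B\<bar> ^ k / Gamma (a * real k + 1) \<le> D * (1/2) ^ k"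
    using power_div_Gamma_le_geometric[of a "\<bar>B\<bar>"] assms by auto
  have "Gamma (a * real k + 1) > 0" for k using assms by (intro Gamma_real_pos) (simp add: add_nonneg_pos)
  then have "norm (B ^ k / Gamma (a * real k + 1)) \<le> D * (1/2) ^ k" for k
    using D[of k] by (simp add: power_abs less_imp_le)
  moreover have "summable (\<lambda>k. D * (1/2) ^ k)" by (intro summable_mult summable_geometric) simp
  ultimately show ?thesis by (rule summable_comparison_test'[of _ 0, rotated])
qed

text \<open>Euler's Beta integral under the substitution r = s + (t - s) x: the scaled factors
  contribute the exponent a + b - 2, the Jacobian the missing 1. For a + b = 1 the value no longer
  depends on s and t, which is what inverts the Caputo kernel.\<close>

lemma has_bochner_integral_beta_kernel:
  assumes "a > 0" "b > 0" "s < (t::real)"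
  shows "has_bochner_integral lborel
    (\<lambda>r. indicator {s<..<t} r * ((r - s) powr (a - 1) * (t - r) powr (b - 1)))
    ((t - s) powr (a + b - 1) * Beta a b)"
proof -
  let ?f = "\<lambda>x. x powr (a - 1) * (1 - x) powr (b - 1)"
  have i: "set_integrable lborel {0..1} ?f" using integrable_Beta assms by blast
  have "(LBINT x:{0..1}. ?f x) = Beta a b"
    using set_borel_integral_eq_integral(2)[OF i] has_integral_Beta_real[of a b] assms
    by (simp add: integral_unique)
  with i have "has_bochner_integral lborel (\<lambda>x. indicator {0..1} x * ?f x) (Beta a b)"
    by (simp add: has_bochner_integral_iff set_integrable_def set_lebesgue_integral_def)
  then have B: "has_bochner_integral lborel (\<lambda>x. indicator {0<..<1} x * ?f x) (Beta a b)"
    by (rule has_bochner_integral_discrete_difference[where X = "{0, 1}", THEN iffD1, rotated 4])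
      (auto split: split_indicator)
  have aff: "- s / (t - s) + 1 / (t - s) * r = (r - s) / (t - s)" for r
    by (simp add: diff_divide_distrib)
  from B have "has_bochner_integral lborel (\<lambda>r. (t - s) powr (a + b - 2) *
      (indicator {0<..<1} (- s / (t - s) + 1 / (t - s) * r) * ?f (- s / (t - s) + 1 / (t - s) * r)))
      ((t - s) powr (a + b - 2) * (Beta a b /\<^sub>R \<bar>1 / (t - s)\<bar>))"
    using lborel_has_bochner_integral_real_affine_iff[of "1 / (t - s)"
        "\<lambda>x. indicator {0<..<1} x * ?f x" "Beta a b" "- s / (t - s)"] assms
    by (intro has_bochner_integral_mult_right) auto
  moreover have "(t - s) powr (a + b - 2) *
      (indicator {0<..<1} (- s / (t - s) + 1 / (t - s) * r) * ?f (- s / (t - s) + 1 / (t - s) * r)) =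
      indicator {s<..<t} r * ((r - s) powr (a - 1) * (t - r) powr (b - 1))" for r
  proof (cases "r \<in> {s<..<t}")
    case True
    then have e1: "indicator {0<..<1} ((r - s) / (t - s)) = (1::real)" using assms by simp
    have e: "1 - (r - s) / (t - s) = (t - r) / (t - s)"
      using assms by (simp add: diff_divide_eq_iff divide_eq_eq eq_divide_eq)
    have "(t - s) powr (a + b - 2) = (t - s) powr (a - 1) * (t - s) powr (b - 1)"
      by (simp add: powr_add[symmetric])
    moreover have "((r - s) / (t - s)) powr (a - 1) = (r - s) powr (a - 1) / (t - s) powr (a - 1)"
      "((t - r) / (t - s)) powr (b - 1) = (t - r) powr (b - 1) / (t - s) powr (b - 1)"
      using True assms by (auto intro!: powr_divide)
    moreover have "(t - s) powr (a - 1) > 0" "(t - s) powr (b - 1) > 0" using assms by auto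
    ultimately show ?thesis using True unfolding aff e e1 by simp
  next
    case False
    then have "(r - s) / (t - s) \<notin> {0<..<1}" using assms by (auto simp: zero_less_divide_iff)
    with False show ?thesis unfolding aff by simp
  qed
  moreover have "(t - s) powr (a + b - 2) * (Beta a b /\<^sub>R \<bar>1 / (t - s)\<bar>) =
      (t - s) powr (a + b - 1) * Beta a b"
  proof -
    have "(t - s) powr (a + b - 1) = (t - s) powr (a + b - 2) * (t - s)"
      using assms powr_add[of "t - s" "a + b - 2" 1] by simp
    then show ?thesis using assms by simp
  qed
  ultimately show ?thesis by (simp only:)
qed

section \<open>Caputo derivatives\<close>

text \<open>The bound is the Riemann-Liouville integral of order a of C t^b at T. For a = 1 the
  slope of g is compared with that of an antiderivative of C t^b. For a < 1, D is integrated against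
  (T - r)^(a - 1); after the exchange of integrals the r-integral is Beta(1 - a, a) whatever s is,
  and the integral of g' over (0,T) remains, which is g T.\<close>

lemma has_caputo_derivative_bound:
  assumes "0 < a" "a \<le> 1" "T > 0" "b \<ge> 0" "C \<ge> 0" "g 0 = 0"
    and cap: "\<And>t. 0 < t \<Longrightarrow> t \<le> T \<Longrightarrow> has_caputo_derivative a g (D t) t"
    and bound: "\<And>t. 0 < t \<Longrightarrow> t \<le> T \<Longrightarrow> \<bar>D t\<bar> \<le> C * t powr b"
  shows "\<bar>g T\<bar> \<le> C * Gamma (b + 1) / Gamma (a + b + 1) * T powr (a + b)"
proof (cases "a = 1")
  case True
  have der: "(g has_real_derivative D t) (at t)" if "t \<in> {0<..T}" for t
    using cap[of t] that True at_within_interior[of t "{0..}"] by (simp add: has_caputo_derivative_def)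
  have cont: "continuous_on {0..T} g"
    using cap[of T] assms True by (simp add: has_caputo_derivative_def)
  define h where "h = (\<lambda>t. C / (b + 1) * t powr (b + 1))"
  have hder: "(h has_real_derivative C * t powr b) (at t)" if "t > 0" for t
    unfolding h_def using that assms by (auto intro!: derivative_eq_intros)
  have hcont: "continuous_on {0..T} h"
    unfolding h_def using assms by (intro continuous_intros continuous_on_powr') auto
  have "h 0 + g 0 \<le> h T + g T"
  proof (rule DERIV_nonneg_imp_increasing_open[of 0 T "\<lambda>t. h t + g t"])
    show "\<exists>y. ((\<lambda>t. h t + g t) has_real_derivative y) (at x) \<and> 0 \<le> y" if "0 < x" "x < T" for x
      using der[of x] hder[of x] bound[of x] that
      by (intro exI[of _ "C * x powr b + D x"]) (auto intro!: derivative_eq_intros simp: abs_le_iff)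
  qed (use assms cont hcont in \<open>auto intro!: continuous_intros\<close>)
  moreover have "h 0 - g 0 \<le> h T - g T"
  proof (rule DERIV_nonneg_imp_increasing_open[of 0 T "\<lambda>t. h t - g t"])
    show "\<exists>y. ((\<lambda>t. h t - g t) has_real_derivative y) (at x) \<and> 0 \<le> y" if "0 < x" "x < T" for x
      using der[of x] hder[of x] bound[of x] that
      by (intro exI[of _ "C * x powr b - D x"]) (auto intro!: derivative_eq_intros simp: abs_le_iff)
  qed (use assms cont hcont in \<open>auto intro!: continuous_intros\<close>)
  moreover have "h 0 = 0" using assms by (simp add: h_def)
  ultimately have "\<bar>g T\<bar> \<le> h T" using \<open>g 0 = 0\<close> by linarith
  moreover have "Gamma (a + b + 1) = (b + 1) * Gamma (b + 1)"
    using Gamma_plus1[of "b + 1"] assms True nonpos_Ints_nonpos[of "b + 1"] by (force simp: add_ac)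
  moreover have "Gamma (b + 1) > 0" using assms by (intro Gamma_real_pos) auto
  ultimately show ?thesis using True by (simp add: h_def add_ac)
next
  case False
  then have a: "0 < a" "a < 1" using assms by auto
  define G where "G = deriv g"
  have pos: "Gamma (1 - a) > 0" "Gamma a > 0" using a by (auto intro!: Gamma_real_pos)
  have cap': "continuous_on {0..t} g \<and> (\<forall>s\<in>{0<..<t}. g differentiable (at s)) \<and>
      set_integrable lborel {0<..<t} (\<lambda>s. G s / (t - s) powr a) \<and>
      (LBINT s:{0<..<t}. G s / (t - s) powr a) = Gamma (1 - a) * D t" if "0 < t" "t \<le> T" for t
    using cap[OF that] False pos by (simp add: has_caputo_derivative_def G_def)
  have cont: "continuous_on {0..T} g" and diff: "\<And>s. 0 < s \<Longrightarrow> s < T \<Longrightarrow> g differentiable (at s)"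
    using cap'[of T] assms(3) by auto
  have int: "set_integrable lborel {0<..<t} (\<lambda>s. G s / (t - s) powr a)"
    and D: "(LBINT s:{0<..<t}. G s / (t - s) powr a) = Gamma (1 - a) * D t" if "0 < t" "t \<le> T" for t
    using cap'[OF that] by auto
  \<comment> \<open>The case t = T of the hypothesis suffices, since (T - s)^a is at most T^a. With
    this the fundamental theorem can be read as a Lebesgue integral.\<close>
  have Gint: "set_integrable lborel {0<..<T} G"
    unfolding set_integrable_def
  proof (rule Bochner_Integration.integrable_bound)
    let ?h = "\<lambda>s. indicator {0<..<T} s *\<^sub>R (G s / (T - s) powr a)"
    have i: "integrable lborel ?h" using int[of T] assms by (simp add: set_integrable_def)
    then show "integrable lborel (\<lambda>s. T powr a * ?h s)" by (rule integrable_mult_right)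
    have [measurable]: "?h \<in> borel_measurable lborel" using i by auto
    have "(\<lambda>s. ?h s * (T - s) powr a) \<in> borel_measurable lborel" by measurable
    also have "(\<lambda>s. ?h s * (T - s) powr a) = (\<lambda>s. indicator {0<..<T} s *\<^sub>R G s)"
      by (auto simp: indicator_def fun_eq_iff)
    finally show "(\<lambda>s. indicator {0<..<T} s *\<^sub>R G s) \<in> borel_measurable lborel" .
    show "AE s in lborel. norm (indicator {0<..<T} s *\<^sub>R G s) \<le> norm (T powr a * ?h s)"
    proof (intro AE_I2)
      fix s show "norm (indicator {0<..<T} s *\<^sub>R G s) \<le> norm (T powr a * ?h s)"
      proof (cases "s \<in> {0<..<T}")
        case True
        then have "(T - s) powr a \<le> T powr a" "(T - s) powr a > 0"
          using a by (auto intro!: powr_mono2)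
        then show ?thesis using True
          by (simp add: abs_mult field_simps mult_left_mono)
      qed simp
    qed
  qed
  have FTC: "(LBINT s:{0<..<T}. G s) = g T"
  proof -
    have "(G has_integral (g T - g 0)) {0..T}"
      using assms cont diff unfolding G_def
      by (intro fundamental_theorem_of_calculus_interior)
         (auto simp: has_real_derivative_iff_has_vector_derivative[symmetric] DERIV_deriv_iff_real_differentiable)
    then have "(G has_integral g T) {0<..<T}"
      using assms by (simp add: has_integral_Icc_iff_Ioo)
    then show ?thesis
      using set_borel_integral_eq_integral(2)[OF Gint] by (simp add: integral_unique)
  qed
  define H where "H = (\<lambda>s. indicator {0<..<T} s * G s)"
  have Hint: "integrable lborel H" using Gint by (simp add: H_def set_integrable_def)
  then have [measurable]: "H \<in> borel_measurable borel" by auto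
  \<comment> \<open>The exponent \<open>1 - a - 1\<close> is left unsimplified to match the Beta
    kernel with parameters 1 - a and a.\<close>
  define F where "F = (\<lambda>s r. H s * (indicator {s<..<T} r * ((r - s) powr (1 - a - 1) * (T - r) powr (a - 1))))"
  have Beta1: "Beta (1 - a) a = Gamma (1 - a) * Gamma a" by (simp add: Beta_def)
  have Fs: "has_bochner_integral lborel (F s) (H s * Beta (1 - a) a)" for s
  proof (cases "s \<in> {0<..<T}")
    case True
    then show ?thesis unfolding F_def
      using has_bochner_integral_beta_kernel[of "1 - a" a s T] a
      by (intro has_bochner_integral_mult_right) auto
  next
    case False then show ?thesis by (simp add: F_def H_def has_bochner_integral_zero)
  qed
  have Fn: "norm (F s r) = \<bar>H s\<bar> * (indicator {s<..<T} r * ((r - s) powr (1 - a - 1) * (T - r) powr (a - 1)))" for s r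
    by (simp add: F_def abs_mult)
  have Fsn: "has_bochner_integral lborel (\<lambda>r. norm (F s r)) (\<bar>H s\<bar> * Beta (1 - a) a)" for s
  proof (cases "s \<in> {0<..<T}")
    case True
    then show ?thesis unfolding Fn
      using has_bochner_integral_beta_kernel[of "1 - a" a s T] a
      by (intro has_bochner_integral_mult_right) auto
  next
    case False then show ?thesis by (simp add: F_def H_def has_bochner_integral_zero)
  qed
  have Fmeas: "case_prod F \<in> borel_measurable (lborel \<Otimes>\<^sub>M lborel)"
  proof -
    have "indicator {s<..<T} r = (if s < r \<and> r < T then 1 else 0 :: real)" for s r by (simp add: indicator_def)
    then show ?thesis unfolding F_def by simp
  qed
  have Fint: "integrable (lborel \<Otimes>\<^sub>M lborel) (case_prod F)"
    using Fmeas
  proof (rule lborel_pair.Fubini_integrable)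
    show "integrable lborel (\<lambda>s. LINT r|lborel. norm (case_prod F (s, r)))"
      using has_bochner_integral_integral_eq[OF Fsn] Hint by simp
    show "AE s in lborel. integrable lborel (\<lambda>r. case_prod F (s, r))"
      using Fs by (auto simp: has_bochner_integral_iff)
  qed
  have "(LINT r|lborel. LINT s|lborel. F s r) = (LINT s|lborel. LINT r|lborel. F s r)"
    by (rule lborel_pair.Fubini_integral[OF Fint])
  also have "\<dots> = (LINT s|lborel. H s * Beta (1 - a) a)"
    using has_bochner_integral_integral_eq[OF Fs] by simp
  also have "\<dots> = Gamma (1 - a) * Gamma a * g T"
    using FTC by (simp add: Beta1 H_def set_lebesgue_integral_def)
  finally have eq: "Gamma (1 - a) * Gamma a * g T = (LINT r|lborel. LINT s|lborel. F s r)" ..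
  have inner: "(LINT s|lborel. F s r) =
      indicator {0<..<T} r * ((T - r) powr (a - 1) * (Gamma (1 - a) * D r))" for r
  proof (cases "r \<in> {0<..<T}")
    case True
    have "F s r = (T - r) powr (a - 1) * (indicator {0<..<r} s *\<^sub>R (G s / (r - s) powr a))" for s
      using True by (simp add: F_def H_def indicator_def powr_minus_divide)
    then have "(LINT s|lborel. F s r) = (T - r) powr (a - 1) * (LBINT s:{0<..<r}. G s / (r - s) powr a)"
      unfolding set_lebesgue_integral_def by (simp only: integral_mult_right_zero)
    then show ?thesis using True D[of r] by simp
  next
    case False
    then have "F s r = 0" for s by (auto simp: F_def H_def indicator_def)
    with False show ?thesis by simp
  qed
  let ?k = "\<lambda>r. C * Gamma (1 - a) * (indicator {0<..<T} r * ((r - 0) powr (b + 1 - 1) * (T - r) powr (a - 1)))"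
  have k: "has_bochner_integral lborel ?k (C * Gamma (1 - a) * ((T - 0) powr (b + 1 + a - 1) * Beta (b + 1) a))"
    using assms by (intro has_bochner_integral_mult_right has_bochner_integral_beta_kernel) auto
  have "norm (LINT r|lborel. LINT s|lborel. F s r) \<le> (LINT r|lborel. ?k r)"
  proof (rule Bochner_Integration.integral_norm_bound_integral)
    \<comment> \<open>\<open>D\<close> is not assumed measurable; the integrability of the outer
      integrand is a by-product of Fubini.\<close>
    show "integrable lborel (\<lambda>r. LINT s|lborel. F s r)"
      by (rule lborel_pair.integrable_snd[OF Fint])
    show "integrable lborel ?k" using k by (simp add: has_bochner_integral_iff)
    show "norm (LINT s|lborel. F s r) \<le> ?k r" for r
      using bound[of r] pos unfolding inner
      by (auto simp: indicator_def abs_mult mult_ac intro!: mult_left_mono)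
  qed
  also have "\<dots> = C * Gamma (1 - a) * (T powr (a + b) * Beta (b + 1) a)"
    using has_bochner_integral_integral_eq[OF k] by (simp add: add_ac)
  finally have "Gamma (1 - a) * Gamma a * \<bar>g T\<bar> \<le> C * Gamma (1 - a) * (T powr (a + b) * Beta (b + 1) a)"
    using pos unfolding eq[symmetric] by (simp add: abs_mult)
  also have "\<dots> = Gamma (1 - a) * Gamma a * (C * Gamma (b + 1) / Gamma (a + b + 1) * T powr (a + b))"
    by (simp add: Beta_def add_ac)
  finally show ?thesis by (rule mult_left_le_imp_le) (use pos in simp)
qed

section \<open>Series in powers of t^a and their Caputo derivatives\<close>

definition mittag_leffler_series :: "real \<Rightarrow> (nat \<Rightarrow> real) \<Rightarrow> real \<Rightarrow> real" where
  "mittag_leffler_series a c t = (\<Sum>k. c k * (t powr a) ^ k / Gamma (a * real k + 1))"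

lemma summable_mittag_leffler_series:
  assumes "a > 0" "\<And>k. \<bar>c k\<bar> \<le> C * B ^ k"
  shows "summable (\<lambda>k. norm (c k * x ^ k / Gamma (a * real k + 1)))"
proof (rule summable_comparison_test'[of _ 0])
  show "summable (\<lambda>k. C * ((B * \<bar>x\<bar>) ^ k / Gamma (a * real k + 1)))"
    using assms by (intro summable_mult summable_power_div_Gamma)
  fix k
  have "Gamma (a * real k + 1) > 0" using assms by (intro Gamma_real_pos) (simp add: add_nonneg_pos)
  then show "norm (norm (c k * x ^ k / Gamma (a * real k + 1))) \<le> C * ((B * \<bar>x\<bar>) ^ k / Gamma (a * real k + 1))"
    using mult_right_mono[OF assms(2)[of k], of "\<bar>x\<bar> ^ k"]
    by (simp add: abs_mult power_abs power_mult_distrib divide_right_mono mult_ac)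
qed

lemma mittag_leffler_series_0:
  "mittag_leffler_series a c 0 = c 0"
  using powser_zero[of "\<lambda>k. c k / Gamma (a * real k + 1)"]
  by (simp add: mittag_leffler_series_def)

lemma continuous_on_mittag_leffler_series:
  assumes "a > 0" "\<And>k. \<bar>c k\<bar> \<le> C * B ^ k"
  shows "continuous_on {0..} (mittag_leffler_series a c)"
proof -
  let ?e = "\<lambda>k. c k / Gamma (a * real k + 1)"
  have "summable (\<lambda>k. ?e k * x ^ k)" for x
    using summable_norm_cancel[OF summable_mittag_leffler_series[OF assms]] by simp
  then have "isCont (\<lambda>x. \<Sum>k. ?e k * x ^ k) x" for x
    by (rule isCont_powser_converges_everywhere)
  then have "continuous_on UNIV (\<lambda>x. \<Sum>k. ?e k * x ^ k)"
    by (simp add: continuous_on_eq_continuous_at)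
  moreover have "continuous_on {0..} (\<lambda>t. t powr a)"
    using assms by (intro continuous_on_powr' continuous_intros) auto
  ultimately have "continuous_on {0..} (\<lambda>t. \<Sum>k. ?e k * (t powr a) ^ k)"
    by (rule continuous_on_compose2) auto
  then show ?thesis by (simp add: mittag_leffler_series_def[abs_def])
qed

text \<open>The Caputo derivative of t^(a (k + 1)) is Gamma(a (k + 1) + 1) / Gamma(a k + 1) times
  t^(a k), which the normalisation turns into an index shift; the constant term disappears. For c k
  = z^k this is the eigenvalue equation of the Mittag-Leffler function. At t = 0 with a < 1 the
  defining integral is 0, whereas the shifted series has the value c 1.\<close>

lemma has_caputo_derivative_mittag_leffler_series:
  assumes "0 < a" "a \<le> 1" and c: "\<And>k. \<bar>c k\<bar> \<le> C * B ^ k" and t: "t > 0 \<or> t = 0 \<and> a = 1"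
  shows "has_caputo_derivative a (mittag_leffler_series a c)
    (mittag_leffler_series a (\<lambda>k. c (Suc k)) t) t"
proof -
  define e where "e d k = d k / Gamma (a * real k + 1)" for d :: "nat \<Rightarrow> real" and k
  have G1: "Gamma (a * real k + 1) > 0" for k using assms by (intro Gamma_real_pos) (simp add: add_nonneg_pos)
  have G2: "Gamma (a * real (Suc k)) > 0" for k using assms by (intro Gamma_real_pos) simp
  have diffs: "diffs (e d) k = d (Suc k) / (a * Gamma (a * real (Suc k)))" for d k
  proof -
    have "Gamma (a * real (Suc k) + 1) = a * real (Suc k) * Gamma (a * real (Suc k))"
      using assms by (intro Gamma_plus1) (auto dest!: nonpos_Ints_nonpos simp: mult_le_0_iff)
    then show ?thesis using assms by (simp add: diffs_def e_def del: of_nat_Suc)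
  qed
  have sum: "summable (\<lambda>k. e d k * x ^ k)" if "\<And>k. \<bar>d k\<bar> \<le> C * B ^ k" for d x
    using summable_norm_cancel[OF summable_mittag_leffler_series[OF assms(1) that]] by (simp add: e_def)
  have series: "mittag_leffler_series a c s = (\<Sum>k. e c k * (s powr a) ^ k)" for s
    by (simp add: mittag_leffler_series_def e_def)
  have der: "((\<lambda>x. \<Sum>k. e c k * x ^ k) has_real_derivative (\<Sum>k. diffs (e c) k * x ^ k)) (at x)" for x
    using sum[OF c] by (rule termdiffs_strong_converges_everywhere)
  show ?thesis
  proof (cases "a = 1")
    case True
    have "(mittag_leffler_series a c has_real_derivative (\<Sum>k. diffs (e c) k * t ^ k)) (at t within {0..})"
    proof (rule has_field_derivative_transform_within[OF _ zero_less_one])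
      show "((\<lambda>x. \<Sum>k. e c k * x ^ k) has_real_derivative (\<Sum>k. diffs (e c) k * t ^ k)) (at t within {0..})"
        using der has_field_derivative_at_within by blast
      show "t \<in> {0..}" using t by auto
      show "(\<Sum>k. e c k * x ^ k) = mittag_leffler_series a c x" if "x \<in> {0..}" for x
        using that unfolding series by (simp add: True)
    qed
    moreover have "(\<Sum>k. diffs (e c) k * t ^ k) = mittag_leffler_series a (\<lambda>k. c (Suc k)) t"
      unfolding mittag_leffler_series_def using t True by (auto simp: diffs add.commute[of 1])
    moreover have "continuous_on {0..t} (mittag_leffler_series a c)"
      using continuous_on_mittag_leffler_series[OF assms(1) c] by (rule continuous_on_subset) auto
    ultimately show ?thesis using True by (simp add: has_caputo_derivative_def)
  next
    case False
    then have a: "a < 1" and t: "t > 0" using assms by auto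
    \<comment> \<open>Term of index k + 1 of the differentiated series, times the Caputo kernel. The
      coefficients \<open>d\<close> are a parameter because the norm of the term for
      \<open>c\<close> is the term for the absolute values of \<open>c\<close>: one formula gives
      both the integrals and their absolute summability.\<close>
    define u where "u d k s = d (Suc k) / Gamma (a * real (Suc k)) *
      (indicator {0<..<t} s * ((s - 0) powr (a * real (Suc k) - 1) * (t - s) powr (1 - a - 1)))"
      for d :: "nat \<Rightarrow> real" and k s
    have u_int: "has_bochner_integral lborel (u d k)
        (Gamma (1 - a) * (d (Suc k) * (t powr a) ^ k / Gamma (a * real k + 1)))" for d k
    proof -
      have "has_bochner_integral lborel (u d k) (d (Suc k) / Gamma (a * real (Suc k)) *
          ((t - 0) powr (a * real (Suc k) + (1 - a) - 1) * Beta (a * real (Suc k)) (1 - a)))"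
        unfolding u_def using assms a t
        by (intro has_bochner_integral_mult_right has_bochner_integral_beta_kernel) auto
      moreover have "a * real (Suc k) + (1 - a) = a * real k + 1" by (simp add: algebra_simps)
      moreover have "t powr (a * real k) = (t powr a) ^ k"
        using t by (simp add: powr_powr[symmetric] powr_realpow)
      ultimately show ?thesis using G2[of k]
        by (simp add: Beta_def field_simps del: of_nat_Suc)
    qed
    have u_eq: "u d k s = indicator {0<..<t} s *
        (diffs (e d) k * (s powr a) ^ k * (a * s powr (a - 1)) / (t - s) powr a)" for d k s
    proof (cases "s \<in> {0<..<t}")
      case True
      have "s powr (a * real (Suc k) - 1) = s powr (a * real k) * s powr (a - 1)"
        by (simp add: powr_add[symmetric] algebra_simps)
      also have "s powr (a * real k) = (s powr a) ^ k"
        using True by (simp add: powr_powr[symmetric] powr_realpow)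
      finally have "s powr (a * real (Suc k) - 1) = (s powr a) ^ k * s powr (a - 1)" .
      with True show ?thesis using assms G2[of k]
        by (simp add: u_def diffs powr_minus_divide del: of_nat_Suc)
    qed (simp add: u_def)
    have dsum: "summable (\<lambda>k. diffs (e d) k * x ^ k)" if "\<And>k. \<bar>d k\<bar> \<le> C * B ^ k" for d x
      using termdiff_converges_all[of "e d" x] sum[OF that] by simp
    have usum: "summable (\<lambda>k. norm (u c k s))" for s
    proof -
      have "norm (u c k s) = \<bar>indicator {0<..<t} s * (a * s powr (a - 1)) / (t - s) powr a\<bar> *
          (diffs (e (\<lambda>k. \<bar>c k\<bar>)) k * (s powr a) ^ k)" for k
        using G2[of k] assms
        by (simp add: u_eq diffs abs_mult abs_divide indicator_def power_abs mult_ac del: of_nat_Suc)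
      then show ?thesis using dsum[of "\<lambda>k. \<bar>c k\<bar>" "s powr a"] c
        by (simp add: summable_mult)
    qed
    have c': "\<bar>c (Suc k)\<bar> \<le> (C * B) * B ^ k" for k using c[of "Suc k"] by (simp add: mult_ac)
    have unorm: "norm (u c k s) = u (\<lambda>k. \<bar>c k\<bar>) k s" for k s
      using G2[of k] by (simp add: u_def abs_mult del: of_nat_Suc)
    have uisum: "summable (\<lambda>k. LINT s|lborel. norm (u c k s))"
    proof -
      have "(LINT s|lborel. norm (u c k s)) =
          Gamma (1 - a) * norm (c (Suc k) * (t powr a) ^ k / Gamma (a * real k + 1))" for k
        using has_bochner_integral_integral_eq[OF u_int[of "\<lambda>k. \<bar>c k\<bar>" k]] G1[of k]
        unfolding unorm by (simp add: abs_mult)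
      then show ?thesis
        using summable_mult[OF summable_mittag_leffler_series[OF assms(1) c', of "t powr a"], of "Gamma (1 - a)"]
        by simp
    qed
    have ui: "integrable lborel (u c k)" for k using u_int by (auto simp: has_bochner_integral_iff)
    have sder: "(mittag_leffler_series a c has_real_derivative
        (\<Sum>k. diffs (e c) k * (s powr a) ^ k) * (a * s powr (a - 1))) (at s)" if "s > 0" for s
      unfolding series[abs_def]
      by (rule DERIV_chain2[OF der]) (use that in \<open>auto intro!: derivative_eq_intros\<close>)
    have sumu: "(\<Sum>k. u c k s) = indicator {0<..<t} s *\<^sub>R (deriv (mittag_leffler_series a c) s / (t - s) powr a)" for s
    proof (cases "s \<in> {0<..<t}")
      case True
      have "(\<Sum>k. u c k s) = (\<Sum>k. diffs (e c) k * (s powr a) ^ k * (a * s powr (a - 1) / (t - s) powr a))"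
        using True by (simp add: u_eq)
      also have "\<dots> = (\<Sum>k. diffs (e c) k * (s powr a) ^ k) * (a * s powr (a - 1) / (t - s) powr a)"
        using suminf_mult2[OF dsum[OF c]] by metis
      finally show ?thesis using True DERIV_imp_deriv[OF sder[of s]] by simp
    qed (simp add: u_eq)
    have I: "integrable lborel (\<lambda>s. \<Sum>k. u c k s)"
      using ui usum uisum by (intro integrable_suminf) auto
    have "(LINT s|lborel. (\<Sum>k. u c k s)) = (\<Sum>k. LINT s|lborel. u c k s)"
      using ui usum uisum by (intro integral_suminf) auto
    also have "\<dots> = (\<Sum>k. Gamma (1 - a) * (c (Suc k) * (t powr a) ^ k / Gamma (a * real k + 1)))"
      using has_bochner_integral_integral_eq[OF u_int] by simp
    also have "\<dots> = Gamma (1 - a) * mittag_leffler_series a (\<lambda>k. c (Suc k)) t"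
      unfolding mittag_leffler_series_def
      by (rule suminf_mult[OF summable_norm_cancel[OF summable_mittag_leffler_series[OF assms(1) c']]])
    finally have "(LBINT s:{0<..<t}. deriv (mittag_leffler_series a c) s / (t - s) powr a) =
        Gamma (1 - a) * mittag_leffler_series a (\<lambda>k. c (Suc k)) t"
      by (simp add: sumu set_lebesgue_integral_def)
    moreover have "set_integrable lborel {0<..<t} (\<lambda>s. deriv (mittag_leffler_series a c) s / (t - s) powr a)"
      using I by (simp add: sumu set_integrable_def)
    moreover have "Gamma (1 - a) > 0" using a by (intro Gamma_real_pos) simp
    moreover have "continuous_on {0..t} (mittag_leffler_series a c)"
      using continuous_on_mittag_leffler_series[OF assms(1) c] by (rule continuous_on_subset) auto
    moreover have "mittag_leffler_series a c differentiable (at s)" if "s \<in> {0<..<t}" for s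
      using sder[of s] that by (auto simp: real_differentiable_def)
    ultimately show ?thesis using False by (simp add: has_caputo_derivative_def)
  qed
qed

text \<open>At t = 0 the defining integral runs over an empty interval. This is the corner case that
  the index shift leaves out.\<close>

lemma has_caputo_derivative_0:
  assumes "a \<noteq> 1"
  shows "has_caputo_derivative a g 0 0"
  using assms by (simp add: has_caputo_derivative_def set_integrable_def set_lebesgue_integral_def)

lemma has_caputo_derivative_diff:
  assumes f: "has_caputo_derivative a f Df t" and g: "has_caputo_derivative a g Dg t"
  shows "has_caputo_derivative a (\<lambda>s. f s - g s) (Df - Dg) t"
proof (cases "a = 1")
  case True
  with assms show ?thesis
    by (auto simp: has_caputo_derivative_def intro!: continuous_intros derivative_intros)
next
  case False
  have d: "deriv (\<lambda>s. f s - g s) s = deriv f s - deriv g s" if "s \<in> {0<..<t}" for s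
    using f g that False
    by (intro DERIV_imp_deriv DERIV_diff) (auto simp: has_caputo_derivative_def DERIV_deriv_iff_real_differentiable)
  let ?h = "\<lambda>f s. deriv f s / (t - s) powr a"
  have i: "set_integrable lborel {0<..<t} (?h f)" "set_integrable lborel {0<..<t} (?h g)"
    using f g False by (auto simp: has_caputo_derivative_def)
  have e: "?h (\<lambda>s. f s - g s) s = ?h f s - ?h g s" if "s \<in> {0<..<t}" for s
    using d[OF that] by (simp add: diff_divide_distrib)
  have "set_integrable lborel {0<..<t} (\<lambda>s. ?h f s - ?h g s)"
    using i by (rule set_integral_diff(1))
  then have "set_integrable lborel {0<..<t} (?h (\<lambda>s. f s - g s))"
    by (subst set_integrable_cong[OF refl refl e]) auto
  moreover have "(LBINT s:{0<..<t}. ?h (\<lambda>s. f s - g s) s) = (LBINT s:{0<..<t}. ?h f s) - (LBINT s:{0<..<t}. ?h g s)"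
    unfolding set_integral_diff(2)[OF i, symmetric]
    by (rule set_lebesgue_integral_cong) (auto simp: e)
  ultimately show ?thesis
    using f g False by (auto simp: has_caputo_derivative_def right_diff_distrib intro!: continuous_intros)
qed

text \<open>The operator sees only nonnegative arguments: inside (0,t) the derivative is local, and
  for a = 1 it is taken within [0, \<infinity>). The formulas for the field and the density are
  available only at nonnegative times.\<close>

lemma has_caputo_derivative_cong:
  assumes "\<And>s. s \<ge> 0 \<Longrightarrow> f s = g s" "t \<ge> 0" "has_caputo_derivative a f D t"
  shows "has_caputo_derivative a g D t"
proof (cases "a = 1")
  case True
  have "continuous_on {0..t} g \<longleftrightarrow> continuous_on {0..t} f"
    using assms(1) by (intro continuous_on_cong) auto
  moreover have "(g has_real_derivative D) (at t within {0..})"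
    if "(f has_real_derivative D) (at t within {0..})"
    using that by (rule has_field_derivative_transform_within[OF _ zero_less_one]) (use assms in auto)
  ultimately show ?thesis using assms(3) True by (simp add: has_caputo_derivative_def)
next
  case False
  have "(g has_real_derivative deriv f s) (at s)" if "s \<in> {0<..<t}" for s
  proof -
    have "(f has_real_derivative deriv f s) (at s)"
      using assms(3) that False by (auto simp: has_caputo_derivative_def DERIV_deriv_iff_real_differentiable)
    then show ?thesis
      by (rule has_field_derivative_transform_within_open[of _ _ _ "{0<..}"]) (use that assms(1) in auto)
  qed
  then have d: "deriv g s = deriv f s" "g differentiable (at s)" if "s \<in> {0<..<t}" for s
    using that by (auto intro: DERIV_imp_deriv simp: real_differentiable_def)
  have "continuous_on {0..t} g \<longleftrightarrow> continuous_on {0..t} f"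
    using assms(1) by (intro continuous_on_cong) auto
  moreover have "set_integrable lborel {0<..<t} (\<lambda>s. deriv g s / (t - s) powr a) \<longleftrightarrow>
      set_integrable lborel {0<..<t} (\<lambda>s. deriv f s / (t - s) powr a)"
    by (rule set_integrable_cong) (auto simp: d)
  moreover have "(LBINT s:{0<..<t}. deriv g s / (t - s) powr a) =
      (LBINT s:{0<..<t}. deriv f s / (t - s) powr a)"
    by (rule set_lebesgue_integral_cong) (auto simp: d)
  ultimately show ?thesis using assms(3) d(2) False by (simp add: has_caputo_derivative_def)
qed

text \<open>The coefficient of x^k / Gamma(a k + 1) in p n: for first index 1, the product of
  falling factorials in the known formula, divided by Gamma(k + 1) = k!, is C(k, n). The exponent
  \<open>k + n\<close> has the parity of k - n and avoids truncated subtraction.\<close>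

definition signed_binomial :: "nat \<Rightarrow> nat \<Rightarrow> real" where
  "signed_binomial k n = (- 1) ^ (k + n) * real (k choose n)"

lemma Suc_times_binomial_Suc:
  "real (Suc j) * real (k choose Suc j) = (real k - real j) * real (k choose j)"
  using gbinomial_mult_1[of "real k" j] by (simp add: binomial_gbinomial algebra_simps)

text \<open>This is why the series solves the field equation: the right-hand side sends the
  coefficients of index k to k + 1 times those of index k + 1, and k + 1 is the factor that
  differentiating t1^(k + 1) produces. For n = 0 the truncated \<open>n - 1\<close> is multiplied by
  0.\<close>

lemma signed_binomial_recurrence:
  "real (n + 1) * signed_binomial k (n + 1) - real (2 * n + 1) * signed_binomial k n
    + real n * signed_binomial k (n - 1) = real (Suc k) * signed_binomial (Suc k) n"
proof (cases n)
  case 0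
  then show ?thesis by (simp add: signed_binomial_def algebra_simps)
next
  case (Suc m)
  have 1: "(m + 2) * real (k choose (m + 2)) = (real k - m - 1) * real (k choose (m + 1))"
    using Suc_times_binomial_Suc[of "Suc m" k] by (simp add: algebra_simps)
  have 2: "(m + 1) * real (k choose (m + 1)) = (real k - m) * real (k choose m)"
    using Suc_times_binomial_Suc[of m k] by (simp add: algebra_simps)
  have 3: "real (Suc k choose Suc m) = real (k choose (m + 1)) + real (k choose m)" by simp
  have "(m + 2) * real (k choose (m + 2)) + (2 * m + 3) * real (k choose (m + 1)) + (m + 1) * real (k choose m)
     = (real k + 1) * real (Suc k choose Suc m)"
    using 1 2 unfolding 3 by (simp add: algebra_simps)
  then have "(- 1) ^ (k + m) * ((m + 2) * real (k choose (m + 2)) + (2 * m + 3) * real (k choose (m + 1)) + (m + 1) * real (k choose m))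
     = (- 1) ^ (k + m) * ((real k + 1) * real (Suc k choose Suc m))" by simp
  then show ?thesis unfolding Suc by (simp add: signed_binomial_def algebra_simps)
qed

text \<open>Counterpart of the recurrence for errors of unknown sign. All three binomials are at
  most C(n + K + 1, K), their weights add up to 4 n + 2 \<le> 4 (n + 1), and (n + 1) C(n + K + 1, K)
  = (K + 1) C(n + K + 1, K + 1).\<close>

lemma binomial_recurrence_bound:
  "real (n + 1) * real ((n + 1 + K) choose K) + real (2 * n + 1) * real ((n + K) choose K)
    + real n * real ((n - 1 + K) choose K) \<le> 4 * real (Suc K) * real ((n + Suc K) choose Suc K)"
proof -
  let ?B = "real (Suc (n + K) choose K)"
  have "(n + K) choose K \<le> Suc (n + K) choose K" "(n - 1 + K) choose K \<le> Suc (n + K) choose K"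
    by (auto intro: binomial_right_mono)
  then have "real (n + 1) * ?B + real (2 * n + 1) * real ((n + K) choose K)
    + real n * real ((n - 1 + K) choose K) \<le> real (n + 1) * ?B + real (2 * n + 1) * ?B + real n * ?B"
    by (intro add_mono mult_left_mono) auto
  also have "\<dots> \<le> 4 * (real (Suc n) * ?B)" by (simp add: algebra_simps)
  also have "real (Suc n) * ?B = real (Suc K) * real (Suc (n + K) choose Suc K)"
    using Suc_times_binomial_add[of K n] by (simp only: of_nat_mult[symmetric] add.commute)
  finally show ?thesis by (simp only: mult.assoc add_Suc_right add_Suc One_nat_def add_0_right)
qed

lemma mittag_leffler_series_finite:
  assumes "\<And>k. k \<ge> K \<Longrightarrow> c k = 0"
  shows "mittag_leffler_series a c t = (\<Sum>k<K. c k * (t powr a) ^ k / Gamma (a * real k + 1))"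
  unfolding mittag_leffler_series_def using assms by (intro suminf_finite) auto

text \<open>Makes finite sums admissible in the series lemmas, with geometric base 1.\<close>

lemma finite_support_bounded:
  fixes c :: "nat \<Rightarrow> real"
  assumes "\<And>k. k \<ge> K \<Longrightarrow> c k = 0"
  shows "\<bar>c k\<bar> \<le> (\<Sum>k<K. \<bar>c k\<bar>) * 1 ^ k"
proof (cases "k < K")
  case True
  then show ?thesis using member_le_sum[of k "{..<K}" "\<lambda>k. \<bar>c k\<bar>"] by simp
qed (simp add: assms sum_nonneg)

section \<open>One-point law of the field\<close>

lemma one_point_prob_bounds:
  assumes "prob_space M"
  shows "0 \<le> one_point_prob M N n t1 t2" "one_point_prob M N n t1 t2 \<le> 1"
  using prob_space.prob_le_1[OF assms] by (auto simp: one_point_prob_def)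

lemma one_point_prob_sums_1:
  assumes "prob_space M" "N t1 t2 \<in> measurable M (count_space UNIV)"
  shows "(\<lambda>n. one_point_prob M N n t1 t2) sums 1"
proof -
  interpret prob_space M by fact
  have "{\<omega> \<in> space M. N t1 t2 \<omega> = n} \<in> events" for n
    using assms(2) by measurable
  then have "(\<lambda>n. prob {\<omega> \<in> space M. N t1 t2 \<omega> = n}) sums prob (\<Union>n. {\<omega> \<in> space M. N t1 t2 \<omega> = n})"
    by (intro finite_measure_UNION) (auto simp: disjoint_family_on_def)
  moreover have "(\<Union>n. {\<omega> \<in> space M. N t1 t2 \<omega> = n}) = space M" by auto
  ultimately show ?thesis by (simp add: prob_space one_point_prob_def)
qed

lemma one_point_prob_degenerate:
  assumes "prob_space M" "N t1 t2 \<in> measurable M (count_space UNIV)" "one_point_prob M N 0 t1 t2 = 1"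
  shows "one_point_prob M N n t1 t2 = of_bool (n = 0)"
proof (cases n)
  case (Suc m)
  let ?p = "\<lambda>n. one_point_prob M N n t1 t2"
  have "sum ?p {0, n} \<le> 1"
    using one_point_prob_sums_1[where N = N, OF assms(1,2)] one_point_prob_bounds[OF assms(1)]
    by (metis (no_types, lifting) finite.intros sum_le_suminf sums_summable sums_unique)
  with assms(3) Suc one_point_prob_bounds(1)[OF assms(1), of N n t1 t2] show ?thesis by simp
qed (use assms in simp)

text \<open>Replacing \<open>p\<close> by the partial sum on the right-hand side of the equation, integrating twice and
  using only \<open>0 \<le> p \<le> 1\<close> shows that the remainder is of the order of the first omitted term, although the
  coefficients grow with \<open>n\<close>: each time integration gains a factor that beats the growth.\<close>

lemma one_point_prob_remainder:
  assumes M: "prob_space M" and lam: "lam > 0" and a: "0 < a" "a \<le> 1"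
    and N: "fractional_poisson_field M lam 1 a N" and t: "t1 \<ge> 0" "t2 \<ge> 0"
  shows "\<bar>one_point_prob M N n t1 t2
      - (\<Sum>k<K. signed_binomial k n * (lam * t1 * t2 powr a) ^ k / Gamma (a * real k + 1))\<bar>
    \<le> 4 ^ K * real ((n + K) choose K) * (lam * t1 * t2 powr a) ^ K / Gamma (a * real K + 1)"
  using t
proof (induction K arbitrary: n t1 t2)
  case 0
  \<comment> \<open>For K = 0 the sum is empty and the bound is 1, so the claim is the a priori
    bound on a probability.\<close>
  show ?case using one_point_prob_bounds[OF M, of N n t1 t2] by simp
next
  case (Suc K)
  define p where "p = one_point_prob M N"
  define G where "G k = Gamma (a * real k + 1)" for k
  define R where "R K n t1 t2 = p n t1 t2 - (\<Sum>k<K. signed_binomial k n * (lam * t1 * t2 powr a) ^ k / G k)"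
    for K n t1 t2
  have G0: "G k > 0" for k unfolding G_def using a by (intro Gamma_real_pos) (simp add: add_nonneg_pos)
  have G_0 [simp]: "G 0 = 1" by (simp add: G_def)
  have IH: "\<bar>R K m r s\<bar> \<le> 4 ^ K * real ((m + K) choose K) * (lam * r * s powr a) ^ K / G K"
    if "r \<ge> 0" "s \<ge> 0" for m r s
    using Suc.IH[OF that] by (simp add: R_def p_def G_def)
  from N have meas: "N r s \<in> measurable M (count_space UNIV)" if "r \<ge> 0" "s \<ge> 0" for r s
    using that by (simp add: fractional_poisson_field_def)
  have "p 0 r 0 = 1" "p 0 0 r = 1" if "r \<ge> 0" for r
    using N that by (auto simp: fractional_poisson_field_def p_def)
  then have init: "p m r 0 = of_bool (m = 0)" "p m 0 r = of_bool (m = 0)" if "r \<ge> 0" for m r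
    using one_point_prob_degenerate[where N = N, OF M meas] that unfolding p_def by blast+
  \<comment> \<open>On the axes only the term k = 0 survives, and it equals the initial law. This
    settles the degenerate case and gives the zero initial value for the integration in t1.\<close>
  have R_bdry: "R (Suc K) n r s = 0" if "r \<ge> 0" "s \<ge> 0" "r = 0 \<or> s = 0" for r s
  proof -
    have "p n r s = of_bool (n = 0)" using that init by auto
    moreover have "(\<Sum>k<Suc K. signed_binomial k n * (lam * r * s powr a) ^ k / G k) = of_bool (n = 0)"
      using that by (subst sum.lessThan_Suc_shift) (auto simp: signed_binomial_def)
    ultimately show ?thesis by (simp add: R_def)
  qed
  show ?case
  proof (cases "t1 > 0 \<and> t2 > 0")
    case False
    then show ?thesis using R_bdry[of t1 t2] Suc.prems G0[of "Suc K"] lam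
      by (auto simp: R_def p_def G_def)
  next
    case True
    \<comment> \<open>The field equation supplies a separate function of the second time at each
      point. Uniqueness of the ordinary derivative identifies all of them with this one on
      nonnegative times, so that it can be integrated in t2.\<close>
    define q where "q r s = deriv (\<lambda>r. p n r s) r" for r s
    define A where "A f = real (n + 1) * f (n + 1) - real (2 * n + 1) * f n + real n * f (n - 1)"
      for f :: "nat \<Rightarrow> real"
    have qex: "\<exists>q. (\<forall>s\<ge>0. has_caputo_derivative 1 (\<lambda>r. p n r s) (q s) r) \<and>
        has_caputo_derivative a q (lam * A (\<lambda>m. p m r s)) s" if "r > 0" "s > 0" for r s
      using N that unfolding fractional_poisson_field_def p_def A_def
      by (auto simp: algebra_simps)
    have c1: "continuous_on {0..r} (\<lambda>r. p n r s)" and d1: "((\<lambda>r. p n r s) has_real_derivative q r s) (at r)"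
      if rs: "r > 0" "s \<ge> 0" for r s
    proof -
      \<comment> \<open>The second time 1 is arbitrary: any positive one yields the t1-derivative
        for all \<open>s \<ge> 0\<close>.\<close>
      from qex[of r 1] rs obtain q' where "has_caputo_derivative 1 (\<lambda>r. p n r s) (q' s) r" by auto
      then have "continuous_on {0..r} (\<lambda>r. p n r s)" "((\<lambda>r. p n r s) has_real_derivative q' s) (at r)"
        using rs at_within_interior[of r "{0..}"] by (auto simp: has_caputo_derivative_def)
      then show "continuous_on {0..r} (\<lambda>r. p n r s)" "((\<lambda>r. p n r s) has_real_derivative q r s) (at r)"
        by (auto simp: q_def DERIV_imp_deriv)
    qed
    have d2: "has_caputo_derivative a (q r) (lam * A (\<lambda>m. p m r s)) s" if rs: "r > 0" "s > 0" for r s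
    proof -
      from qex[OF rs] obtain q' where q': "\<And>s. s \<ge> 0 \<Longrightarrow> has_caputo_derivative 1 (\<lambda>r. p n r s) (q' s) r"
        "has_caputo_derivative a q' (lam * A (\<lambda>m. p m r s)) s" by auto
      have "q' u = q r u" if "u \<ge> 0" for u
        using q'(1)[OF that] rs at_within_interior[of r "{0..}"]
        by (auto simp: has_caputo_derivative_def q_def DERIV_imp_deriv)
      then show ?thesis using has_caputo_derivative_cong[OF _ _ q'(2), of "q r"] rs by simp
    qed
    \<comment> \<open>On the axis t2 = 0 the law is constant in r; this is the initial value for the
      integration in t2.\<close>
    have q0: "q r 0 = 0" if "r > 0" for r
    proof -
      have "((\<lambda>r. p n r 0) has_real_derivative 0) (at r)"
        by (rule has_field_derivative_transform_within_open[OF DERIV_const[of "of_bool (n = 0)"], of "{0<..}"])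
          (use that init in auto)
      then show ?thesis by (simp add: q_def DERIV_imp_deriv)
    qed
    \<comment> \<open>Coefficients of the r-derivative of the partial sum with K + 1 terms. For
      \<open>k = 0\<close> the exponent \<open>k - 1\<close> is truncated, but the factor
      \<open>real k\<close> vanishes.\<close>
    define w where "w r k = (if k \<le> K then signed_binomial k n * real k * lam ^ k * r ^ (k - 1) else 0)" for r k
    define W where "W r = mittag_leffler_series a (w r)" for r
    have W_eq: "W r s = (\<Sum>k<Suc K. signed_binomial k n * (real k * lam ^ k * r ^ (k - 1)) * (s powr a) ^ k / G k)" for r s
      unfolding W_def by (subst mittag_leffler_series_finite[where K = "Suc K"]) (auto simp: w_def G_def mult.assoc intro!: sum.cong)
    \<comment> \<open>Index shift and recurrence turn the K + 1 terms into the right-hand side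
      evaluated at the K-term sums, that is, at \<open>p - R K\<close>. Hence q - W has the
      right-hand side of \<open>R K\<close> as its Caputo derivative, and the induction hypothesis
      applies.\<close>
    have W_caputo: "has_caputo_derivative a (W r) (lam * A (\<lambda>m. p m r s - R K m r s)) s" if "s > 0" for r s
    proof -
      have "has_caputo_derivative a (W r) (mittag_leffler_series a (\<lambda>k. w r (Suc k)) s) s"
        unfolding W_def
        by (rule has_caputo_derivative_mittag_leffler_series[where B = 1, OF a finite_support_bounded[where K = "Suc K"]])
          (use that in \<open>auto simp: w_def\<close>)
      also have "mittag_leffler_series a (\<lambda>k. w r (Suc k)) s =
          (\<Sum>k<K. w r (Suc k) * (s powr a) ^ k / G k)"
        by (subst mittag_leffler_series_finite[where K = K]) (auto simp: w_def G_def)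
      also have "\<dots> = (\<Sum>k<K. lam * A (signed_binomial k) * (lam * r * s powr a) ^ k / G k)"
        unfolding A_def signed_binomial_recurrence
        by (intro sum.cong) (auto simp: w_def power_mult_distrib)
      also have "\<dots> = lam * A (\<lambda>m. \<Sum>k<K. signed_binomial k m * (lam * r * s powr a) ^ k / G k)"
        unfolding A_def
        by (simp add: sum_distrib_left sum_subtractf[symmetric] sum.distrib[symmetric] algebra_simps
            diff_divide_distrib add_divide_distrib)
      finally show ?thesis by (simp add: R_def)
    qed
    define E where "E = 4 ^ Suc K * real ((n + Suc K) choose Suc K)"
    have E0: "E \<ge> 0" by (simp add: E_def)
    have A_bound: "\<bar>lam * A (\<lambda>m. R K m r s)\<bar> \<le> lam * (real (Suc K) * E) * (lam * r) ^ K / G K * s powr (a * real K)"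
      if "r > 0" "s > 0" for r s
    proof -
      let ?z = "(lam * r * s powr a) ^ K / G K"
      have factor: "i * (u * j * v) + k * (u * l * v) + m * (u * q * v) = u * v * (i * j + k * l + m * q)"
        for i j k l m q u v :: real by (simp add: algebra_simps)
      have z: "?z \<ge> 0" using that lam G0[of K] by simp
      have "\<bar>A (\<lambda>m. R K m r s)\<bar> \<le> \<bar>real (n + 1) * R K (n + 1) r s\<bar> + \<bar>real (2 * n + 1) * R K n r s\<bar> + \<bar>real n * R K (n - 1) r s\<bar>"
        unfolding A_def by linarith
      also have "\<dots> = real (n + 1) * \<bar>R K (n + 1) r s\<bar> + real (2 * n + 1) * \<bar>R K n r s\<bar> + real n * \<bar>R K (n - 1) r s\<bar>"
        by (simp only: abs_mult abs_of_nat)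
      also have "\<dots> \<le> real (n + 1) * (4 ^ K * real ((n + 1 + K) choose K) * ?z)
          + real (2 * n + 1) * (4 ^ K * real ((n + K) choose K) * ?z) + real n * (4 ^ K * real ((n - 1 + K) choose K) * ?z)"
        using IH[of r s "n + 1"] IH[of r s n] IH[of r s "n - 1"] that
        by (intro add_mono mult_left_mono) simp_all
      also have "\<dots> = 4 ^ K * ?z * (real (n + 1) * real ((n + 1 + K) choose K) + real (2 * n + 1) * real ((n + K) choose K)
          + real n * real ((n - 1 + K) choose K))" by (rule factor)
      also have "\<dots> \<le> 4 ^ K * ?z * (4 * real (Suc K) * real ((n + Suc K) choose Suc K))"
        by (rule mult_left_mono[OF binomial_recurrence_bound], rule mult_nonneg_nonneg[OF _ z]) simp
      also have "\<dots> = real (Suc K) * E * ?z"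
        by (simp add: E_def del: binomial_Suc_Suc add_Suc_right of_nat_Suc)
      also have "?z = (lam * r) ^ K / G K * s powr (a * real K)"
        using that by (simp add: power_mult_distrib powr_powr[symmetric] powr_realpow)
      finally have "\<bar>A (\<lambda>m. R K m r s)\<bar> \<le> real (Suc K) * E * ((lam * r) ^ K / G K * s powr (a * real K))" .
      from mult_left_mono[OF this, of lam] show ?thesis using lam by (simp add: abs_mult mult.assoc)
    qed
    have q_bound: "\<bar>q r t2 - W r t2\<bar> \<le> lam ^ Suc K * (real (Suc K) * E) / G (Suc K) * t2 powr (a * real (Suc K)) * r powr real K"
      if r: "r > 0" for r
    proof -
      have "\<bar>q r t2 - W r t2\<bar> \<le> lam * (real (Suc K) * E) * (lam * r) ^ K / G K * Gamma (a * real K + 1) /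
          Gamma (a + a * real K + 1) * t2 powr (a + a * real K)"
      proof (rule has_caputo_derivative_bound[OF a])
        fix s assume s: "0 < s" "s \<le> t2"
        show "has_caputo_derivative a (\<lambda>s. q r s - W r s) (lam * A (\<lambda>m. R K m r s)) s"
          using has_caputo_derivative_diff[OF d2[OF r s(1)] W_caputo[OF s(1), of r]]
          by (simp add: A_def algebra_simps)
        show "\<bar>lam * A (\<lambda>m. R K m r s)\<bar> \<le> lam * (real (Suc K) * E) * (lam * r) ^ K / G K * s powr (a * real K)"
          using A_bound r s by blast
      next
        show "q r 0 - W r 0 = 0" by (simp add: q0[OF r] W_def mittag_leffler_series_0 w_def)
        show "0 \<le> lam * (real (Suc K) * E) * (lam * r) ^ K / G K" using lam r E0 G0[of K] by simp
      qed (use True a in auto)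
      also have "\<dots> = lam ^ Suc K * (real (Suc K) * E) / G (Suc K) * t2 powr (a * real (Suc K)) * r powr real K"
      proof -
        have "Gamma (a * real K + 1) = G K" "Gamma (a + a * real K + 1) = G (Suc K)"
          and "a * real (Suc K) = a + a * real K" by (simp_all add: G_def algebra_simps)
        then show ?thesis
          using G0[of K] r by (simp add: powr_realpow power_mult_distrib del: of_nat_Suc)
      qed
      finally show ?thesis .
    qed
    \<comment> \<open>Integration of r^K in t1 gives the factor Gamma(K + 1) / Gamma(K + 2) = 1 / (K
      + 1), which cancels the \<open>real (Suc K)\<close> left by the binomial bound.\<close>
    have "\<bar>R (Suc K) n t1 t2\<bar> \<le> lam ^ Suc K * (real (Suc K) * E) / G (Suc K) * t2 powr (a * real (Suc K)) *
        Gamma (real K + 1) / Gamma (1 + real K + 1) * t1 powr (1 + real K)"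
    proof (rule has_caputo_derivative_bound)
      fix r assume r: "0 < r" "r \<le> t1"
      have "((\<lambda>r. \<Sum>k<Suc K. signed_binomial k n * (lam * r * t2 powr a) ^ k / G k) has_real_derivative W r t2) (at r)"
      proof -
        have "((\<lambda>r. \<Sum>k<Suc K. signed_binomial k n * (lam * r * t2 powr a) ^ k / G k) has_real_derivative
            (\<Sum>k<Suc K. signed_binomial k n * (real k * (lam * r * t2 powr a) ^ (k - 1) * (lam * t2 powr a)) / G k)) (at r)"
          by (intro DERIV_sum DERIV_cdivide DERIV_cmult) (auto intro!: derivative_eq_intros)
        moreover have "signed_binomial k n * (real k * (lam * r * t2 powr a) ^ (k - 1) * (lam * t2 powr a)) / G k =
            signed_binomial k n * (real k * lam ^ k * r ^ (k - 1)) * (t2 powr a) ^ k / G k" for k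
          by (cases k) (simp_all add: power_mult_distrib)
        ultimately show ?thesis unfolding W_eq by (simp only:)
      qed
      then have "((\<lambda>r. R (Suc K) n r t2) has_real_derivative q r t2 - W r t2) (at r)"
        unfolding R_def using d1[of r t2] r True by (intro DERIV_diff) auto
      then have "((\<lambda>r. R (Suc K) n r t2) has_real_derivative q r t2 - W r t2) (at r within {0..})"
        by (rule has_field_derivative_at_within)
      moreover have "continuous_on {0..r} (\<lambda>r. R (Suc K) n r t2)"
        unfolding R_def using c1[of r t2] r True G0 by (intro continuous_intros) (auto simp: less_imp_neq[OF G0, symmetric])
      ultimately show "has_caputo_derivative 1 (\<lambda>r. R (Suc K) n r t2) (q r t2 - W r t2) r"
        by (simp add: has_caputo_derivative_def)
      show "\<bar>q r t2 - W r t2\<bar> \<le> lam ^ Suc K * (real (Suc K) * E) / G (Suc K) * t2 powr (a * real (Suc K)) * r powr real K"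
        using q_bound r by blast
    next
      show "R (Suc K) n 0 t2 = 0" using R_bdry True by simp
      show "0 \<le> lam ^ Suc K * (real (Suc K) * E) / G (Suc K) * t2 powr (a * real (Suc K))"
        using lam E0 G0[of "Suc K"] by simp
    qed (use True in auto)
    also have "\<dots> = E * (lam * t1 * t2 powr a) ^ Suc K / G (Suc K)"
    proof -
      have "Gamma (real K + 1) = fact K" "Gamma (1 + real K + 1) = real (Suc K) * fact K"
        using Gamma_fact[of K, where 'a = real] Gamma_fact[of "Suc K", where 'a = real] by (simp_all add: add_ac)
      moreover have "t1 powr (1 + real K) = t1 ^ Suc K"
        using True powr_realpow[of t1 "Suc K"] by (simp add: add_ac)
      moreover have "t2 powr (a * real (Suc K)) = (t2 powr a) ^ Suc K"
        using True by (simp only: powr_powr[symmetric]) (simp add: powr_realpow[of _ "Suc K"] del: of_nat_Suc)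
      ultimately show ?thesis by (simp add: power_mult_distrib del: of_nat_Suc power_Suc)
    qed
    finally show ?thesis by (simp add: R_def p_def G_def E_def)
  qed
qed

text \<open>C(n + K, K) \<le> 2^(n + K) separates n from K: the factor 2^n can be summed against
  Erlang densities, and 8 is 4 times 2.\<close>

lemma one_point_prob_remainder_geometric:
  assumes "prob_space M" "lam > 0" and a: "0 < a" "a \<le> 1"
    and "fractional_poisson_field M lam 1 a N" "t1 \<ge> 0" "t2 \<ge> 0"
  shows "\<bar>one_point_prob M N n t1 t2
      - (\<Sum>k<K. signed_binomial k n * (lam * t1 * t2 powr a) ^ k / Gamma (a * real k + 1))\<bar>
    \<le> 2 ^ n * ((8 * (lam * t1 * t2 powr a)) ^ K / Gamma (a * real K + 1))"
proof -
  define x where "x = lam * t1 * t2 powr a"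
  have x: "x \<ge> 0" using assms by (simp add: x_def)
  have "real ((n + K) choose K) \<le> real (2 ^ (n + K))"
    by (intro of_nat_mono binomial_le_pow2)
  moreover have "Gamma (a * real K + 1) > 0" using a by (intro Gamma_real_pos) (simp add: add_nonneg_pos)
  ultimately have "4 ^ K * real ((n + K) choose K) * x ^ K / Gamma (a * real K + 1)
      \<le> 4 ^ K * 2 ^ (n + K) * x ^ K / Gamma (a * real K + 1)"
    using x by (intro divide_right_mono mult_right_mono mult_left_mono) auto
  also have "4 ^ K * 2 ^ (n + K) = (2 :: real) ^ n * 8 ^ K"
    by (simp add: power_add power_mult_distrib[symmetric])
  finally show ?thesis
    using one_point_prob_remainder[OF assms, of n K] unfolding x_def
    by (simp add: power_mult_distrib mult_ac)
qed

lemma one_point_prob_sums: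
  assumes "prob_space M" "lam > 0" and a: "0 < a" "a \<le> 1"
    and "fractional_poisson_field M lam 1 a N" "t1 \<ge> 0" "t2 \<ge> 0"
  shows "(\<lambda>k. signed_binomial k n * (lam * t1 * t2 powr a) ^ k / Gamma (a * real k + 1))
    sums one_point_prob M N n t1 t2"
  unfolding sums_def
proof (rule LIM_zero_cancel, rule Lim_null_comparison)
  let ?x = "lam * t1 * t2 powr a"
  show "\<forall>\<^sub>F K in sequentially. norm ((\<Sum>k<K. signed_binomial k n * ?x ^ k / Gamma (a * real k + 1))
      - one_point_prob M N n t1 t2) \<le> 2 ^ n * ((8 * ?x) ^ K / Gamma (a * real K + 1))"
    using one_point_prob_remainder_geometric[OF assms, of n]
    by (intro always_eventually allI) (simp only: real_norm_def abs_minus_commute)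
  show "(\<lambda>K. 2 ^ n * ((8 * ?x) ^ K / Gamma (a * real K + 1))) \<longlonglongrightarrow> 0"
    using tendsto_mult_right_zero[OF summable_LIMSEQ_zero[OF summable_power_div_Gamma[OF a(1)]]] .
qed

lemma pochhammer_div_fact_eq_binomial:
  "pochhammer (real n + 1) k / fact k = real ((k + n) choose n)"
proof -
  have "(fact (n + k) :: real) = fact n * pochhammer (real n + 1) k"
    using pochhammer_product'[of "1 :: real" n k] by (simp add: pochhammer_fact add_ac)
  then show ?thesis by (simp add: binomial_fact add_ac)
qed

lemma one_point_prob_mittag_leffler:
  assumes "prob_space M" "lam > 0" "0 < a" "a \<le> 1"
    and "fractional_poisson_field M lam 1 a N" "t1 \<ge> 0" "t2 \<ge> 0"
  shows "one_point_prob M N n t1 t2 =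
    (lam * t1 * t2 powr a) ^ n * mittag_leffler3 a (real n * a + 1) (real n + 1) (- lam * t1 * t2 powr a)"
proof -
  define x where "x = lam * t1 * t2 powr a"
  define f where "f k = signed_binomial k n * x ^ k / Gamma (a * real k + 1)" for k
  define e where "e k = pochhammer (real n + 1) k * (- x) ^ k / (Gamma (a * real k + (real n * a + 1)) * fact k)" for k
  have s: "f sums one_point_prob M N n t1 t2"
    using one_point_prob_sums[OF assms, of n] by (simp add: f_def[abs_def] x_def)
  have "f k = 0" if "k < n" for k using that by (simp add: f_def signed_binomial_def)
  with s have "(\<lambda>k. f (k + n)) sums one_point_prob M N n t1 t2"
    using sums_iff_shift'[of f n] by simp
  moreover have "f (k + n) = x ^ n * e k" for k
    using pochhammer_div_fact_eq_binomial[of n k, symmetric]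
    by (simp add: f_def e_def signed_binomial_def power_add power_minus[of x] algebra_simps)
  ultimately have e: "(\<lambda>k. x ^ n * e k) sums one_point_prob M N n t1 t2" by simp
  show ?thesis
  \<comment> \<open>If x^n = 0, both sides vanish; otherwise division by x^n recovers the sum of
    \<open>e\<close>.\<close>
  proof (cases "x ^ n = 0")
    case True
    then have "one_point_prob M N n t1 t2 = 0" using sums_unique[OF e[unfolded True]] by simp
    then show ?thesis by (simp only: True[unfolded x_def] mult_zero_left)
  next
    case False
    then have "e sums (one_point_prob M N n t1 t2 / x ^ n)"
      using sums_mult_D[OF e] by simp
    then have "(\<Sum>k. e k) = one_point_prob M N n t1 t2 / x ^ n" by (rule sums_unique[symmetric])
    with False show ?thesis
      by (simp add: mittag_leffler3_def e_def x_def mult_ac)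
  qed
qed

section \<open>Mixtures of Erlang densities\<close>

lemma erlang_density_sums:
  assumes "l > 0" "x > 0"
  shows "(\<lambda>n. erlang_density n l x) sums l"
proof -
  have "(\<lambda>n. l * exp (- l * x) * ((l * x) ^ n /\<^sub>R fact n)) sums (l * exp (- l * x) * exp (l * x))"
    by (intro sums_mult exp_converges)
  moreover have "l * exp (- l * x) * ((l * x) ^ n /\<^sub>R fact n) = erlang_density n l x" for n
    using assms by (simp add: erlang_density_def power_mult_distrib field_simps)
  ultimately show ?thesis by (simp add: mult.assoc exp_add[symmetric])
qed

text \<open>Monotone convergence for extended nonnegative integrals. The set \<open>A\<close> stays
  free because both {..y}, for the distribution function, and {0<..}, for the total mass, are
  needed.\<close>

lemma erlang_mixture_has_integral:
  fixes p c :: "nat \<Rightarrow> real"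
  assumes l: "l > 0" and p: "\<And>n. 0 \<le> p n" "\<And>n. p n \<le> 1" and c: "\<And>n. 0 \<le> c n"
    and A: "A \<in> sets borel"
    and int: "\<And>n. (\<integral>\<^sup>+x. ennreal (erlang_density n l x) * indicator A x \<partial>lborel) = ennreal (c n)"
    and r: "(\<lambda>n. p n * c n) sums r"
  shows "has_bochner_integral lborel
    (\<lambda>x. indicator A x * (if x > 0 then \<Sum>n. p n * erlang_density n l x else 0)) r"
proof (rule has_bochner_integral_nn_integral)
  let ?f = "\<lambda>x. if x > 0 then \<Sum>n. p n * erlang_density n l x else 0"
  have sm: "summable (\<lambda>n. p n * erlang_density n l x)" if "x > 0" for x
    by (rule summable_comparison_test'[OF sums_summable[OF erlang_density_sums[OF l that]], of 0])
       (use p l in \<open>auto simp: abs_mult mult_left_le_one_le\<close>)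
  have nn: "0 \<le> p n * erlang_density n l x" for n x using p l by simp
  show "(\<lambda>x. indicator A x * ?f x) \<in> borel_measurable lborel" using A by measurable
  show "AE x in lborel. 0 \<le> indicator A x * ?f x"
    by (auto intro!: AE_I2 mult_nonneg_nonneg suminf_nonneg[OF sm nn])
  show "0 \<le> r" by (rule sums_le[OF _ sums_zero r]) (use p c in simp)
  have "(\<integral>\<^sup>+x. ennreal (indicator A x * ?f x) \<partial>lborel) =
      (\<integral>\<^sup>+x. (\<Sum>n. ennreal (p n) * (ennreal (erlang_density n l x) * indicator A x)) \<partial>lborel)"
  \<comment> \<open>The integrands may differ at 0: the mixture is set to 0 there, while
    \<open>erlang_density 0 l\<close> has the value \<open>l\<close>.\<close>
  proof (rule nn_integral_cong_AE, rule AE_mp[OF AE_lborel_singleton[of 0]], rule AE_I2, rule impI)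
    fix x :: real assume "x \<noteq> 0"
    show "ennreal (indicator A x * ?f x) = (\<Sum>n. ennreal (p n) * (ennreal (erlang_density n l x) * indicator A x))"
    proof (cases "x > 0")
      case True
      have "(\<Sum>n. ennreal (p n) * (ennreal (erlang_density n l x) * indicator A x)) =
          (\<Sum>n. ennreal (p n * erlang_density n l x)) * indicator A x"
        using p l by (simp add: ennreal_mult mult.assoc[symmetric])
      also have "(\<Sum>n. ennreal (p n * erlang_density n l x)) = ennreal (\<Sum>n. p n * erlang_density n l x)"
        by (rule suminf_ennreal2[OF nn sm[OF True]])
      finally show ?thesis using True by (simp add: indicator_def)
    next
      case False
      with \<open>x \<noteq> 0\<close> show ?thesis by (simp add: erlang_density_def)
    qed
  qed
  also have "\<dots> = (\<Sum>n. ennreal (p n) * (\<integral>\<^sup>+x. ennreal (erlang_density n l x) * indicator A x \<partial>lborel))"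
    using A by (simp add: nn_integral_suminf nn_integral_cmult)
  also have "\<dots> = (\<Sum>n. ennreal (p n * c n))" using p c by (simp add: int ennreal_mult)
  also have "\<dots> = ennreal r"
    unfolding sums_unique[OF r] using p c by (intro suminf_ennreal2 sums_summable[OF r]) simp
  finally show "(\<integral>\<^sup>+x. ennreal (indicator A x * ?f x) \<partial>lborel) = ennreal r" .
qed

text \<open>Index \<open>n\<close> stands for n + 1 jumps throughout:
  \<open>erlang_density n\<close> is the Gamma density of shape n + 1. The factor y
  exp(\<open>\<sigma>\<close> y) undoes the prefactor of the density.\<close>

lemma density_term_eq:
  assumes "prob_space M" "lam > 0" "0 < a" "a \<le> 1"
    and "fractional_poisson_field M lam 1 a N" "t1 \<ge> 0" "t2 \<ge> 0" "y > 0"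
  shows "density_term lam \<sigma> a y t1 t2 n =
    one_point_prob M N (Suc n) t1 t2 * (y * exp (\<sigma> * y) * erlang_density n \<sigma> y)"
  using \<open>y > 0\<close> one_point_prob_mittag_leffler[OF assms(1-7), of "Suc n"]
  by (simp add: density_term_def erlang_density_def power_mult_distrib exp_minus add_ac mult_ac)

lemma summable_density_term:
  assumes "prob_space M" "lam > 0" "0 < a" "a \<le> 1"
    and "fractional_poisson_field M lam 1 a N" "t1 \<ge> 0" "t2 \<ge> 0" "y > 0" "\<sigma> > 0"
  shows "summable (density_term lam \<sigma> a y t1 t2)"
proof (rule summable_comparison_test')
  show "summable (\<lambda>n. y * exp (\<sigma> * y) * erlang_density n \<sigma> y)"
    using erlang_density_sums[OF assms(9,8)] by (intro summable_mult) (simp add: sums_iff)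
  show "norm (density_term lam \<sigma> a y t1 t2 n) \<le> y * exp (\<sigma> * y) * erlang_density n \<sigma> y" if "n \<ge> 0" for n
    using assms one_point_prob_bounds[OF assms(1), of N "Suc n" t1 t2]
    by (simp add: density_term_eq[OF assms(1-8)] abs_mult mult_left_le_one_le)
qed

lemma compound_density_eq:
  assumes "prob_space M" "lam > 0" "0 < a" "a \<le> 1"
    and "fractional_poisson_field M lam 1 a N" "t1 \<ge> 0" "t2 \<ge> 0" "\<sigma> > 0"
  shows "compound_density lam \<sigma> a y t1 t2 =
    (if y > 0 then \<Sum>n. one_point_prob M N (Suc n) t1 t2 * erlang_density n \<sigma> y else 0)"
proof (cases "y > 0")
  case True
  have "compound_density lam \<sigma> a y t1 t2 = (\<Sum>n. exp (- \<sigma> * y) / y * density_term lam \<sigma> a y t1 t2 n)"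
    using suminf_mult[OF summable_density_term[OF assms(1-7) True assms(8)], of "exp (- \<sigma> * y) / y"] True
    by (simp add: compound_density_def)
  also have "\<dots> = (\<Sum>n. one_point_prob M N (Suc n) t1 t2 * erlang_density n \<sigma> y)"
    using True by (intro suminf_cong) (simp add: density_term_eq[OF assms(1-7) True] exp_minus field_simps)
  finally show ?thesis using True by simp
qed (simp add: compound_density_def)

section \<open>Law of the compound field\<close>

lemma sum_exponential_distributed:
  assumes "prob_space M" "\<sigma> > 0"
    and "\<And>j. j \<ge> 1 \<Longrightarrow> distributed M lborel (Y j) (exponential_density \<sigma>)"
    and "prob_space.indep_vars M (\<lambda>_. borel) Y {1..}"
  shows "distributed M lborel (\<lambda>\<omega>. \<Sum>j=1..Suc n. Y j \<omega>) (erlang_density n \<sigma>)"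
proof -
  interpret prob_space M by fact
  have "indep_vars (\<lambda>_. borel) Y {1..Suc n}"
    by (rule indep_vars_subset[OF assms(4)]) auto
  then show ?thesis
    using exponential_distributed_sum[where I = "{1..Suc n}" and X = Y and l = \<sigma>] assms(2,3) by simp
qed

text \<open>The event is split by the value of N at the single point (t1,t2). Independence is given
  for the sigma-algebras of the two whole families, so the partial sum has to be written through the
  coordinates of \<open>f\<close> and the level set of N through one coordinate of
  \<open>g\<close>.\<close>

lemma compound_field_prob_sums:
  assumes M: "prob_space M"
    and N: "N t1 t2 \<in> measurable M (count_space UNIV)" and t: "t1 \<ge> 0" "t2 \<ge> 0"
    and Y: "\<And>j. j \<ge> 1 \<Longrightarrow> Y j \<in> borel_measurable M"
    and indep: "prob_space.indep_set M
       (sets (vimage_algebra (space M) (\<lambda>\<omega>. \<lambda>j\<in>{1..}. Y j \<omega>) (PiM {1..} (\<lambda>_. borel))))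
       (sets (vimage_algebra (space M) (\<lambda>\<omega>. \<lambda>t\<in>{0..} \<times> {0..}. N (fst t) (snd t) \<omega>)
         (PiM ({0..} \<times> {0..}) (\<lambda>_. count_space UNIV))))"
  shows "(\<lambda>n. one_point_prob M N n t1 t2 * measure M {\<omega> \<in> space M. (\<Sum>j=1..n. Y j \<omega>) \<le> y})
    sums measure M {\<omega> \<in> space M. compound_field N Y t1 t2 \<omega> \<le> y}"
proof -
  interpret prob_space M by fact
  define f where "f = (\<lambda>\<omega>. \<lambda>j\<in>{1::nat..}. Y j \<omega>)"
  define g where "g = (\<lambda>\<omega>. \<lambda>t\<in>{0::real..} \<times> {0::real..}. N (fst t) (snd t) \<omega>)"
  let ?F = "vimage_algebra (space M) f (PiM {1..} (\<lambda>_. borel :: real measure))"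
  let ?G = "vimage_algebra (space M) g (PiM ({0..} \<times> {0..}) (\<lambda>_. count_space (UNIV :: nat set)))"
  have f: "f \<in> measurable ?F (PiM {1..} (\<lambda>_. borel))"
    by (rule measurable_vimage_algebra1) (auto simp: f_def space_PiM)
  have g: "g \<in> measurable ?G (PiM ({0..} \<times> {0..}) (\<lambda>_. count_space UNIV))"
    by (rule measurable_vimage_algebra1) (auto simp: g_def space_PiM)
  define S where "S n = {\<omega> \<in> space M. (\<Sum>j=1..n. Y j \<omega>) \<le> y}" for n
  define E where "E n = {\<omega> \<in> space M. N t1 t2 \<omega> = n}" for n
  have S_F: "S n \<in> sets ?F" for n
  proof -
    have "(\<lambda>\<omega>. f \<omega> j) \<in> borel_measurable ?F" if "j \<in> {1..n}" for j
      using measurable_compose[OF f measurable_component_singleton[of j]] that by simp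
    then have "(\<lambda>\<omega>. \<Sum>j=1..n. f \<omega> j) \<in> borel_measurable ?F" by (rule borel_measurable_sum)
    then have "{\<omega> \<in> space ?F. (\<Sum>j=1..n. f \<omega> j) \<le> y} \<in> sets ?F" by measurable
    then show ?thesis by (simp add: S_def f_def)
  qed
  have E_G: "E n \<in> sets ?G" for n
  proof -
    have "(\<lambda>\<omega>. g \<omega> (t1, t2)) \<in> measurable ?G (count_space UNIV)"
      using measurable_compose[OF g measurable_component_singleton[of "(t1, t2)"]] t by simp
    then have "{\<omega> \<in> space ?G. g \<omega> (t1, t2) = n} \<in> sets ?G" by measurable
    then show ?thesis using t by (simp add: E_def g_def)
  qed
  have "prob (S n \<inter> E n) = prob (S n) * prob (E n)" for n
    using indep_setD[OF indep S_F[unfolded f_def] E_G[unfolded g_def], of n n] .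
  moreover have "S n \<inter> E n \<in> events" for n
  proof -
    have [measurable]: "Y j \<in> borel_measurable M" if "j \<in> {1..n}" for j using Y that by simp
    note N[measurable]
    show ?thesis unfolding S_def E_def by measurable
  qed
  then have "(\<lambda>n. prob (S n \<inter> E n)) sums prob (\<Union>n. S n \<inter> E n)"
    by (intro finite_measure_UNION) (auto simp: disjoint_family_on_def E_def)
  moreover have "(\<Union>n. S n \<inter> E n) = {\<omega> \<in> space M. compound_field N Y t1 t2 \<omega> \<le> y}"
    by (auto simp: S_def E_def compound_field_def)
  ultimately show ?thesis by (simp add: S_def E_def one_point_prob_def mult.commute)
qed

locale compound_poisson_field = prob_space M for M :: "'a measure" +
  fixes N :: "real \<Rightarrow> real \<Rightarrow> 'a \<Rightarrow> nat" and Y :: "nat \<Rightarrow> 'a \<Rightarrow> real" and lam \<sigma> a :: real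
  assumes lam: "lam > 0" and \<sigma>: "\<sigma> > 0" and a: "0 < a" "a \<le> 1"
    and field: "fractional_poisson_field M lam 1 a N"
    and exp_Y: "\<And>j. j \<ge> 1 \<Longrightarrow> distributed M lborel (Y j) (exponential_density \<sigma>)"
    and indep_Y: "indep_vars (\<lambda>_. borel) Y {1..}"
    and indep_YN: "indep_set
       (sets (vimage_algebra (space M) (\<lambda>\<omega>. \<lambda>j\<in>{1..}. Y j \<omega>) (PiM {1..} (\<lambda>_. borel))))
       (sets (vimage_algebra (space M) (\<lambda>\<omega>. \<lambda>t\<in>{0..} \<times> {0..}. N (fst t) (snd t) \<omega>)
         (PiM ({0..} \<times> {0..}) (\<lambda>_. count_space UNIV))))"
begin

abbreviation "f \<equiv> compound_density lam \<sigma> a"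

lemma measurable_N: "t1 \<ge> 0 \<Longrightarrow> t2 \<ge> 0 \<Longrightarrow> N t1 t2 \<in> measurable M (count_space UNIV)"
  using field by (simp add: fractional_poisson_field_def)

lemma one_point_prob_0:
  assumes "t1 \<ge> 0" "t2 \<ge> 0"
  shows "one_point_prob M N 0 t1 t2 = mittag_leffler a 1 (- lam * t1 * t2 powr a)"
  using one_point_prob_mittag_leffler[OF prob_space_axioms lam a field assms, of 0]
  by (simp add: mittag_leffler_def)

lemma density_has_integral:
  assumes t: "t1 \<ge> 0" "t2 \<ge> 0" and A: "A \<in> sets borel" and c: "\<And>n. 0 \<le> c n"
    and int: "\<And>n. (\<integral>\<^sup>+x. ennreal (erlang_density n \<sigma> x) * indicator A x \<partial>lborel) = ennreal (c n)"
    and r: "(\<lambda>n. one_point_prob M N (Suc n) t1 t2 * c n) sums r"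
  shows "set_integrable lborel A (\<lambda>x. f x t1 t2)" "(LBINT x:A. f x t1 t2) = r"
proof -
  have "has_bochner_integral lborel (\<lambda>x. indicator A x * f x t1 t2) r"
    unfolding compound_density_eq[OF prob_space_axioms lam a field t \<sigma>]
    using one_point_prob_bounds[OF prob_space_axioms, of N]
    by (intro erlang_mixture_has_integral[OF \<sigma> _ _ c A int r])
  then show "set_integrable lborel A (\<lambda>x. f x t1 t2)" "(LBINT x:A. f x t1 t2) = r"
    by (auto simp: has_bochner_integral_iff set_integrable_def set_lebesgue_integral_def)
qed

lemma compound_field_cdf:
  assumes t: "t1 \<ge> 0" "t2 \<ge> 0"
  shows "set_integrable lborel {..y} (\<lambda>x. f x t1 t2)"
    and "prob {\<omega> \<in> space M. compound_field N Y t1 t2 \<omega> \<le> y} =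
      mittag_leffler a 1 (- lam * t1 * t2 powr a) * indicator {0..} y + (LBINT x:{..y}. f x t1 t2)"
proof -
  define c where "c n = prob {\<omega> \<in> space M. (\<Sum>j=1..n. Y j \<omega>) \<le> y}" for n
  have Y: "Y j \<in> borel_measurable M" if "j \<ge> 1" for j
    using distributed_measurable[OF exp_Y[OF that]] by simp
  have s: "(\<lambda>n. one_point_prob M N n t1 t2 * c n) sums
      prob {\<omega> \<in> space M. compound_field N Y t1 t2 \<omega> \<le> y}"
    unfolding c_def
    by (rule compound_field_prob_sums[OF prob_space_axioms measurable_N[OF t] t Y indep_YN])
  have int: "(\<integral>\<^sup>+x. ennreal (erlang_density n \<sigma> x) * indicator {..y} x \<partial>lborel) = ennreal (c (Suc n))" for n
    using distributed_emeasure[OF sum_exponential_distributed[OF prob_space_axioms \<sigma> exp_Y indep_Y], of "{..y}" n]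
    by (simp add: c_def emeasure_eq_measure vimage_def Int_def conj_commute del: sum.cl_ivl_Suc)
  \<comment> \<open>The empty sum is 0 and its distribution function is this indicator: the source
    of the atom. All other n contribute Erlang laws.\<close>
  have c0: "c 0 = indicator {0..} y" by (simp add: c_def indicator_def prob_space)
  have r: "(\<lambda>n. one_point_prob M N (Suc n) t1 t2 * c (Suc n)) sums
      (prob {\<omega> \<in> space M. compound_field N Y t1 t2 \<omega> \<le> y} - one_point_prob M N 0 t1 t2 * c 0)"
    using s by (subst sums_Suc_iff) simp
  have "0 \<le> c n" for n by (simp add: c_def)
  from density_has_integral[OF t _ this int r]
  show "set_integrable lborel {..y} (\<lambda>x. f x t1 t2)"
    "prob {\<omega> \<in> space M. compound_field N Y t1 t2 \<omega> \<le> y} =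
      mittag_leffler a 1 (- lam * t1 * t2 powr a) * indicator {0..} y + (LBINT x:{..y}. f x t1 t2)"
    by (auto simp: c0 one_point_prob_0[OF t])
qed

text \<open>Every Erlang law has full mass on the positive half-line, so the total is the sum of p
  (n + 1), which is 1 - p 0.\<close>

lemma compound_density_total:
  assumes t: "t1 \<ge> 0" "t2 \<ge> 0"
  shows "set_integrable lborel {0<..} (\<lambda>y. f y t1 t2)"
    and "(LBINT y:{0<..}. f y t1 t2) = 1 - mittag_leffler a 1 (- lam * t1 * t2 powr a)"
proof -
  have int: "(\<integral>\<^sup>+x. ennreal (erlang_density n \<sigma> x) * indicator {0<..} x \<partial>lborel) = ennreal 1" for n
  proof -
    have "(\<integral>\<^sup>+x. ennreal (erlang_density n \<sigma> x) * indicator {0<..} x \<partial>lborel) =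
        (\<integral>\<^sup>+x. ennreal (erlang_density n \<sigma> x * x ^ 0) \<partial>lborel)"
      by (rule nn_integral_cong_AE, rule AE_mp[OF AE_lborel_singleton[of 0]])
        (auto simp: erlang_density_def indicator_def)
    then show ?thesis using nn_integral_erlang_ith_moment[OF \<sigma>, of n 0] by simp
  qed
  have r: "(\<lambda>n. one_point_prob M N (Suc n) t1 t2 * 1) sums (1 - one_point_prob M N 0 t1 t2)"
    using one_point_prob_sums_1[where N = N, OF prob_space_axioms measurable_N[OF t]]
    by (subst sums_Suc_iff) (simp del: One_nat_def)
  from density_has_integral[OF t _ _ int r]
  show "set_integrable lborel {0<..} (\<lambda>y. f y t1 t2)"
    "(LBINT y:{0<..}. f y t1 t2) = 1 - mittag_leffler a 1 (- lam * t1 * t2 powr a)"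
    by (auto simp: one_point_prob_0[OF t])
qed

end

section \<open>Differential equation for the density\<close>

lemma signed_binomial_Suc_Suc:
  "signed_binomial (Suc k) (Suc n) = signed_binomial k n - signed_binomial k (Suc n)"
  by (simp add: signed_binomial_def algebra_simps)

lemma erlang_density_le:
  assumes "l > 0" "x > 0"
  shows "erlang_density n l x \<le> l"
  using sum_le_suminf[of "\<lambda>n. erlang_density n l x" "{n}"] erlang_density_sums[OF assms] assms
  by (simp add: sums_iff)

lemma erlang_density_has_real_derivative:
  assumes "x > 0"
  shows "(erlang_density n l has_real_derivative
    l * ((if n = 0 then 0 else erlang_density (n - 1) l x) - erlang_density n l x)) (at x)"
proof (rule has_field_derivative_transform_within_open)
  have "((\<lambda>x. l ^ Suc n * x ^ n * exp (- l * x) / fact n) has_real_derivative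
      l ^ Suc n * (real n * x ^ (n - 1) * exp (- l * x) - l * x ^ n * exp (- l * x)) / fact n) (at x)"
    by (rule DERIV_cdivide) (auto intro!: derivative_eq_intros simp: algebra_simps)
  also have "l ^ Suc n * (real n * x ^ (n - 1) * exp (- l * x) - l * x ^ n * exp (- l * x)) / fact n =
      l * ((if n = 0 then 0 else erlang_density (n - 1) l x) - erlang_density n l x)"
    using assms
    by (cases n) (simp_all add: erlang_density_def right_diff_distrib diff_divide_distrib mult_ac del: of_nat_Suc)
  finally show "((\<lambda>x. l ^ Suc n * x ^ n * exp (- l * x) / fact n) has_real_derivative
      l * ((if n = 0 then 0 else erlang_density (n - 1) l x) - erlang_density n l x)) (at x)" .
  show "l ^ Suc n * y ^ n * exp (- l * y) / fact n = erlang_density n l y" if "y \<in> {0<..}" for y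
    using that by (simp add: erlang_density_def)
qed (use assms in auto)

text \<open>The coefficients are \<open>(-1)\<^bsup>k-1\<^esup> l exp(- l y) L\<^sub>k\<^sub>-\<^sub>1(l y)\<close> with the associated Laguerre
  polynomials of order \<open>1\<close>.\<close>

definition laguerre_coeff :: "real \<Rightarrow> nat \<Rightarrow> real \<Rightarrow> real" where
  "laguerre_coeff l k y = (\<Sum>n<k. signed_binomial k (Suc n) * erlang_density n l y)"

text \<open>For k \<ge> 1 and y > 0 this is (-1)^k l^2 exp(-l y) times the associated Laguerre
  polynomial of order 2 and degree k - 1 at l y. Pascal's rule has already merged the two sums that
  differentiating Erlang densities leaves.\<close>

definition laguerre_coeff_deriv :: "real \<Rightarrow> nat \<Rightarrow> real \<Rightarrow> real" where
  "laguerre_coeff_deriv l k y = - l * (\<Sum>n<k. signed_binomial (Suc k) (n + 2) * erlang_density n l y)"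

lemma laguerre_coeff_has_real_derivative:
  assumes "y > 0"
  shows "(laguerre_coeff l k has_real_derivative laguerre_coeff_deriv l k y) (at y)"
proof -
  let ?e = "\<lambda>n. erlang_density n l y"
  \<comment> \<open>The shift loses one term; the term added at the top has the coefficient C(k, k +
    1) = 0.\<close>
  have shift: "(\<Sum>n<k. signed_binomial k (Suc n) * (if n = 0 then 0 else ?e (n - 1))) =
      (\<Sum>n<k. signed_binomial k (n + 2) * ?e n)"
  proof (cases k)
    case (Suc j)
    have "signed_binomial (Suc j) (Suc (Suc j)) = 0"
      by (simp add: signed_binomial_def binomial_eq_0 del: binomial_Suc_Suc)
    then show ?thesis
      by (subst Suc, subst sum.lessThan_Suc_shift) (simp add: Suc)
  qed simp
  have "(laguerre_coeff l k has_real_derivative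
      (\<Sum>n<k. signed_binomial k (Suc n) * (l * ((if n = 0 then 0 else ?e (n - 1)) - ?e n)))) (at y)"
    unfolding laguerre_coeff_def[abs_def]
    by (intro DERIV_sum DERIV_cmult erlang_density_has_real_derivative assms)
  also have "(\<Sum>n<k. signed_binomial k (Suc n) * (l * ((if n = 0 then 0 else ?e (n - 1)) - ?e n))) =
      l * ((\<Sum>n<k. signed_binomial k (Suc n) * (if n = 0 then 0 else ?e (n - 1)))
        - (\<Sum>n<k. signed_binomial k (Suc n) * ?e n))"
    by (simp only: sum_distrib_left sum_subtractf[symmetric] right_diff_distrib mult.left_commute)
  also have "\<dots> = laguerre_coeff_deriv l k y"
    unfolding shift laguerre_coeff_deriv_def
    by (simp add: signed_binomial_Suc_Suc left_diff_distrib sum_subtractf right_diff_distrib)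
  finally show ?thesis .
qed

lemma laguerre_coeff_recurrence:
  "l * laguerre_coeff l (Suc k) y + laguerre_coeff_deriv l (Suc k) y = - laguerre_coeff_deriv l k y"
proof -
  let ?e = "\<lambda>n. erlang_density n l y"
  have pascal: "signed_binomial (Suc k) (Suc n) - signed_binomial (Suc (Suc k)) (n + 2) =
      signed_binomial (Suc k) (n + 2)" for n
    using signed_binomial_Suc_Suc[of "Suc k" "Suc n"] by simp
  have "l * laguerre_coeff l (Suc k) y + laguerre_coeff_deriv l (Suc k) y =
      l * (\<Sum>n<Suc k. (signed_binomial (Suc k) (Suc n) - signed_binomial (Suc (Suc k)) (n + 2)) * ?e n)"
    unfolding laguerre_coeff_def laguerre_coeff_deriv_def
    by (simp only: left_diff_distrib sum_subtractf right_diff_distrib mult_minus_left add_uminus_conv_diff)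
  also have "\<dots> = l * (\<Sum>n<Suc k. signed_binomial (Suc k) (n + 2) * ?e n)"
    by (simp only: pascal)
  \<comment> \<open>The extra term n = k has the coefficient C(k + 1, k + 2) = 0.\<close>
  also have "l * (\<Sum>n<Suc k. signed_binomial (Suc k) (n + 2) * ?e n) =
      l * (\<Sum>n<k. signed_binomial (Suc k) (n + 2) * ?e n)"
    by (simp add: signed_binomial_def binomial_eq_0 del: binomial_Suc_Suc)
  finally show ?thesis by (simp add: laguerre_coeff_deriv_def)
qed

text \<open>Each Erlang density is at most l, and a row of binomials adds up to 2^k. The offset
  \<open>j\<close> is 1 for the coefficients and 2 for their derivatives. Since y does not enter the
  bound, the differentiated series converges uniformly on the whole half-line.\<close>

lemma sum_binomial_erlang_le:
  assumes l: "l > 0" and y: "y > 0"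
  shows "\<bar>\<Sum>n<m. signed_binomial k (n + j) * erlang_density n l y\<bar> \<le> l * 2 ^ k"
proof -
  have "\<bar>\<Sum>n<m. signed_binomial k (n + j) * erlang_density n l y\<bar> \<le>
      (\<Sum>n<m. \<bar>signed_binomial k (n + j) * erlang_density n l y\<bar>)" by (rule sum_abs)
  also have "\<dots> \<le> (\<Sum>n<m. real (k choose (n + j)) * l)"
    using erlang_density_le[OF l y] l
    by (intro sum_mono) (simp add: signed_binomial_def abs_mult mult_left_mono)
  also have "\<dots> = l * (\<Sum>i\<in>(\<lambda>n. n + j) ` {..<m}. real (k choose i))"
    by (simp add: sum.reindex sum_distrib_left mult.commute)
  also have "(\<Sum>i\<in>(\<lambda>n. n + j) ` {..<m}. real (k choose i)) \<le> (\<Sum>i\<le>k + (m + j). real (k choose i))"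
    by (intro sum_mono2) auto
  also have "(\<Sum>i\<le>k + (m + j). real (k choose i)) = (\<Sum>i\<le>k. real (k choose i))"
    by (intro sum.mono_neutral_right) auto
  also have "\<dots> = 2 ^ k" using choose_row_sum[of k] by (simp flip: of_nat_sum of_nat_power)
  finally show ?thesis using l by simp
qed

lemma laguerre_coeff_bound:
  assumes "l > 0" "y > 0"
  shows "\<bar>laguerre_coeff l k y\<bar> \<le> l * 2 ^ k"
  using sum_binomial_erlang_le[OF assms, of k 1 k] by (simp add: laguerre_coeff_def)

lemma laguerre_coeff_deriv_bound:
  assumes "l > 0" "y > 0"
  shows "\<bar>laguerre_coeff_deriv l k y\<bar> \<le> 2 * l\<^sup>2 * 2 ^ k"
  using mult_left_mono[OF sum_binomial_erlang_le[OF assms, of "Suc k" 2 k], of l] assms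
  by (simp add: laguerre_coeff_deriv_def abs_mult power2_eq_square)

section \<open>Expansion of the density in powers of t2^a\<close>

context compound_poisson_field
begin

text \<open>Exchange of the sums over n and k without treating a double series: the remainder of p
  (n + 1) after K terms is summed over n against the Erlang densities and tends to 0 as K
  grows.\<close>

lemma compound_density_sums:
  assumes t: "t1 \<ge> 0" "t2 \<ge> 0" and y: "y > 0"
  shows "(\<lambda>k. laguerre_coeff \<sigma> k y * (lam * t1 * t2 powr a) ^ k / Gamma (a * real k + 1))
    sums f y t1 t2"
  unfolding sums_def
proof (rule LIM_zero_cancel, rule Lim_null_comparison)
  let ?x = "lam * t1 * t2 powr a"
  let ?G = "\<lambda>k. Gamma (a * real k + 1)"
  let ?e = "\<lambda>n. erlang_density n \<sigma> y"
  let ?p = "\<lambda>n. one_point_prob M N n t1 t2"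
  have "summable (\<lambda>n. ?p (Suc n) * ?e n)"
    by (rule summable_comparison_test'[OF sums_summable[OF erlang_density_sums[OF \<sigma> y]], of 0])
      (use one_point_prob_bounds[OF prob_space_axioms, of N] \<sigma> in \<open>auto simp: abs_mult mult_left_le_one_le\<close>)
  then have f_sums: "(\<lambda>n. ?p (Suc n) * ?e n) sums f y t1 t2"
    using y by (simp add: compound_density_eq[OF prob_space_axioms lam a field t \<sigma>] sums_iff)
  have "(\<lambda>n. signed_binomial k (Suc n) * ?e n) sums laguerre_coeff \<sigma> k y" for k
    unfolding laguerre_coeff_def by (rule sums_finite) (auto simp: signed_binomial_def)
  then have part: "(\<lambda>n. \<Sum>k<K. signed_binomial k (Suc n) * ?e n * ?x ^ k / ?G k) sums
      (\<Sum>k<K. laguerre_coeff \<sigma> k y * ?x ^ k / ?G k)" for K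
    by (intro sums_sum sums_divide sums_mult2)
  \<comment> \<open>Doubling the rate absorbs the weight 2^(n + 1) at the cost of
    exp(\<open>\<sigma>\<close> y), so the weighted sum is finite.\<close>
  have "2 ^ Suc n * ?e n = exp (\<sigma> * y) * erlang_density n (2 * \<sigma>) y" for n
  proof -
    have "exp (\<sigma> * y) * exp (- (2 * \<sigma>) * y) = exp (- \<sigma> * y)"
      by (simp only: exp_add[symmetric]) simp
    then show ?thesis
      using y by (simp add: erlang_density_def power_mult_distrib)
  qed
  moreover have "(\<lambda>n. exp (\<sigma> * y) * erlang_density n (2 * \<sigma>) y) sums (exp (\<sigma> * y) * (2 * \<sigma>))"
    by (intro sums_mult erlang_density_sums) (use \<sigma> y in auto)
  ultimately have weight: "(\<lambda>n. 2 ^ Suc n * ?e n) sums (exp (\<sigma> * y) * (2 * \<sigma>))"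
    by (simp only:)
  show "\<forall>\<^sub>F K in sequentially. norm ((\<Sum>k<K. laguerre_coeff \<sigma> k y * ?x ^ k / ?G k) - f y t1 t2)
      \<le> exp (\<sigma> * y) * (2 * \<sigma>) * ((8 * ?x) ^ K / ?G K)"
  proof (rule always_eventually, rule allI, rule norm_sums_le)
    fix K n
    show "(\<lambda>n. (\<Sum>k<K. signed_binomial k (Suc n) * ?e n * ?x ^ k / ?G k) - ?p (Suc n) * ?e n) sums
        ((\<Sum>k<K. laguerre_coeff \<sigma> k y * ?x ^ k / ?G k) - f y t1 t2)"
      by (rule sums_diff[OF part f_sums])
    show "(\<lambda>n. 2 ^ Suc n * ?e n * ((8 * ?x) ^ K / ?G K)) sums (exp (\<sigma> * y) * (2 * \<sigma>) * ((8 * ?x) ^ K / ?G K))"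
      by (rule sums_mult2[OF weight])
    have factor: "(\<Sum>k<K. signed_binomial k (Suc n) * ?e n * ?x ^ k / ?G k) - ?p (Suc n) * ?e n =
        ((\<Sum>k<K. signed_binomial k (Suc n) * ?x ^ k / ?G k) - ?p (Suc n)) * ?e n"
      by (simp add: left_diff_distrib right_diff_distrib sum_distrib_left sum_distrib_right mult_ac)
    have "norm (((\<Sum>k<K. signed_binomial k (Suc n) * ?x ^ k / ?G k) - ?p (Suc n)) * ?e n) =
        \<bar>?p (Suc n) - (\<Sum>k<K. signed_binomial k (Suc n) * ?x ^ k / ?G k)\<bar> * ?e n"
      using \<sigma> by (simp add: abs_mult abs_minus_commute)
    also have "\<dots> \<le> 2 ^ Suc n * ((8 * ?x) ^ K / ?G K) * ?e n"
      by (rule mult_right_mono[OF one_point_prob_remainder_geometric[OF prob_space_axioms lam a field t]])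
        (use \<sigma> in simp)
    also have "\<dots> = 2 ^ Suc n * ?e n * ((8 * ?x) ^ K / ?G K)"
      by (simp add: mult_ac)
    finally show "norm ((\<Sum>k<K. signed_binomial k (Suc n) * ?e n * ?x ^ k / ?G k) - ?p (Suc n) * ?e n)
        \<le> 2 ^ Suc n * ?e n * ((8 * ?x) ^ K / ?G K)"
      unfolding factor .
  qed
  show "(\<lambda>K. exp (\<sigma> * y) * (2 * \<sigma>) * ((8 * ?x) ^ K / ?G K)) \<longlonglongrightarrow> 0"
    using tendsto_mult_right_zero[OF summable_LIMSEQ_zero[OF summable_power_div_Gamma[OF a(1)]]] .
qed

lemma compound_density_eq_series:
  assumes "t1 \<ge> 0" "t2 \<ge> 0" "y > 0"
  shows "f y t1 t2 = mittag_leffler_series a (\<lambda>k. laguerre_coeff \<sigma> k y * (lam * t1) ^ k) t2"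
  using sums_unique[OF compound_density_sums[OF assms]]
  by (simp add: mittag_leffler_series_def power_mult_distrib mult_ac)

lemma compound_density_has_real_derivative:
  assumes t: "t1 \<ge> 0" "t2 \<ge> 0" and y: "y > 0"
  shows "((\<lambda>x. f x t1 t2) has_real_derivative
    mittag_leffler_series a (\<lambda>k. laguerre_coeff_deriv \<sigma> k y * (lam * t1) ^ k) t2) (at y)"
proof (rule has_field_derivative_transform_within_open[where S = "{0<..}"])
  let ?u = "\<lambda>k x. laguerre_coeff \<sigma> k x * (lam * t1) ^ k * (t2 powr a) ^ k / Gamma (a * real k + 1)"
  let ?u' = "\<lambda>k x. laguerre_coeff_deriv \<sigma> k x * (lam * t1) ^ k * (t2 powr a) ^ k / Gamma (a * real k + 1)"
  have "((\<lambda>x. \<Sum>k. ?u k x) has_real_derivative (\<Sum>k. ?u' k y)) (at y)"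
  proof (rule has_field_derivative_series'[of "{0<..}"])
    show "(?u k has_real_derivative ?u' k x) (at x within {0<..})" if "x \<in> {0<..}" for k x
      by (rule has_field_derivative_at_within,
          intro DERIV_cdivide DERIV_cmult_right laguerre_coeff_has_real_derivative)
        (use that in simp)
    show "uniformly_convergent_on {0<..} (\<lambda>n x. \<Sum>k<n. ?u' k x)"
    proof (rule Weierstrass_m_test')
      fix k and x :: real assume x: "x \<in> {0<..}"
      have "Gamma (a * real k + 1) > 0" using a by (intro Gamma_real_pos) (simp add: add_nonneg_pos)
      moreover have "0 \<le> (lam * t1) ^ k * (t2 powr a) ^ k" using t lam by simp
      ultimately show "norm (?u' k x) \<le> 2 * \<sigma>\<^sup>2 * ((2 * (lam * t1) * t2 powr a) ^ k / Gamma (a * real k + 1))"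
        using mult_right_mono[OF laguerre_coeff_deriv_bound[OF \<sigma>, of x k], of "(lam * t1) ^ k * (t2 powr a) ^ k"] x t lam
        by (simp add: abs_mult power_mult_distrib divide_right_mono mult_ac)
      next
      show "summable (\<lambda>k. 2 * \<sigma>\<^sup>2 * ((2 * (lam * t1) * t2 powr a) ^ k / Gamma (a * real k + 1)))"
        by (intro summable_mult summable_power_div_Gamma a)
    qed
    show "summable (\<lambda>k. ?u k y)"
      using sums_summable[OF compound_density_sums[OF t y]] by (simp add: power_mult_distrib mult_ac)
  qed (use y in \<open>auto simp: interior_open\<close>)
  then show "((\<lambda>x. mittag_leffler_series a (\<lambda>k. laguerre_coeff \<sigma> k x * (lam * t1) ^ k) t2) has_real_derivative
      mittag_leffler_series a (\<lambda>k. laguerre_coeff_deriv \<sigma> k y * (lam * t1) ^ k) t2) (at y)"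
    by (simp add: mittag_leffler_series_def)
qed (use y compound_density_eq_series[OF t] in auto)

lemma compound_density_equation:
  assumes t: "t1 \<ge> 0" "t2 \<ge> 0" and y: "y > 0"
  defines "fy \<equiv> mittag_leffler_series a (\<lambda>k. laguerre_coeff_deriv \<sigma> k y * (lam * t1) ^ k)"
  obtains Df Dfy where "has_caputo_derivative a (\<lambda>s. f y t1 s) Df t2"
    "has_caputo_derivative a fy Dfy t2" "\<sigma> * Df = - (lam * t1 * fy t2 + Dfy)"
proof -
  define c where "c k = laguerre_coeff \<sigma> k y * (lam * t1) ^ k" for k
  define d where "d k = laguerre_coeff_deriv \<sigma> k y * (lam * t1) ^ k" for k
  have b: "\<bar>c k\<bar> \<le> \<sigma> * (2 * (lam * t1)) ^ k" "\<bar>d k\<bar> \<le> 2 * \<sigma>\<^sup>2 * (2 * (lam * t1)) ^ k" for k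
    using mult_right_mono[OF laguerre_coeff_bound[OF \<sigma> y, of k], of "(lam * t1) ^ k"]
      mult_right_mono[OF laguerre_coeff_deriv_bound[OF \<sigma> y, of k], of "(lam * t1) ^ k"] t lam
    by (simp_all add: c_def d_def abs_mult power_mult_distrib mult_ac)
  have fy: "fy = mittag_leffler_series a d" by (simp add: fy_def d_def[abs_def])
  have cong: "has_caputo_derivative a (\<lambda>s. f y t1 s) D t2"
    if "has_caputo_derivative a (mittag_leffler_series a c) D t2" for D
    using compound_density_eq_series[OF t(1) _ y]
    by (intro has_caputo_derivative_cong[OF _ t(2) that]) (simp add: c_def[abs_def])
  show ?thesis
  \<comment> \<open>At t2 = 0 with a < 1 both Caputo derivatives are 0, and so is
    \<open>fy 0\<close>, since the coefficient of index 0 is an empty sum.\<close>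
  proof (cases "t2 > 0 \<or> t2 = 0 \<and> a = 1")
    case False
    then have "t2 = 0" "a \<noteq> 1" using t by auto
    moreover have "fy 0 = 0"
      by (simp add: fy mittag_leffler_series_0 d_def laguerre_coeff_deriv_def)
    ultimately show ?thesis
      using that[of 0 0] cong[of 0] has_caputo_derivative_0[of a] by simp
  next
    case True
    let ?c' = "\<lambda>k. c (Suc k)" and ?d' = "\<lambda>k. d (Suc k)"
    have b': "\<bar>?c' k\<bar> \<le> (\<sigma> * (2 * (lam * t1))) * (2 * (lam * t1)) ^ k"
      "\<bar>?d' k\<bar> \<le> (2 * \<sigma>\<^sup>2 * (2 * (lam * t1))) * (2 * (lam * t1)) ^ k" for k
      using b[of "Suc k"] by (simp_all add: mult_ac)
    have sums: "(\<lambda>k. e k * (t2 powr a) ^ k / Gamma (a * real k + 1)) sums mittag_leffler_series a e t2"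
      if "\<And>k. \<bar>e k\<bar> \<le> C * B ^ k" for e C B
      using summable_norm_cancel[OF summable_mittag_leffler_series[OF a(1) that]]
      by (simp add: mittag_leffler_series_def summable_sums)
    have "(\<lambda>k. \<sigma> * (?c' k * (t2 powr a) ^ k / Gamma (a * real k + 1))
        + (lam * t1 * (d k * (t2 powr a) ^ k / Gamma (a * real k + 1))
        + ?d' k * (t2 powr a) ^ k / Gamma (a * real k + 1)))
      sums (\<sigma> * mittag_leffler_series a ?c' t2 + (lam * t1 * mittag_leffler_series a d t2 + mittag_leffler_series a ?d' t2))"
      by (intro sums_add sums_mult sums[OF b(2)] sums[OF b'(1)] sums[OF b'(2)])
    moreover have "\<sigma> * (?c' k * (t2 powr a) ^ k / Gamma (a * real k + 1))
        + (lam * t1 * (d k * (t2 powr a) ^ k / Gamma (a * real k + 1))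
        + ?d' k * (t2 powr a) ^ k / Gamma (a * real k + 1)) = 0" for k
    proof -
      \<comment> \<open>The coefficient \<open>d k\<close> has one power of lam t1 fewer than its
        shifted companions; this is the origin of the term lam t1 in the equation.\<close>
      have "\<sigma> * ?c' k + lam * t1 * d k + ?d' k = (lam * t1) ^ Suc k *
          ((\<sigma> * laguerre_coeff \<sigma> (Suc k) y + laguerre_coeff_deriv \<sigma> (Suc k) y) + laguerre_coeff_deriv \<sigma> k y)"
        by (simp add: c_def d_def algebra_simps)
      also have "\<dots> = 0" by (simp add: laguerre_coeff_recurrence)
      finally have "(\<sigma> * ?c' k + lam * t1 * d k + ?d' k) * ((t2 powr a) ^ k / Gamma (a * real k + 1)) = 0" by simp
      then show ?thesis by (simp add: algebra_simps add_divide_distrib)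
    qed
    ultimately have "\<sigma> * mittag_leffler_series a ?c' t2 +
        (lam * t1 * mittag_leffler_series a d t2 + mittag_leffler_series a ?d' t2) = 0"
      by (simp add: sums_iff)
    then have "\<sigma> * mittag_leffler_series a ?c' t2 = - (lam * t1 * fy t2 + mittag_leffler_series a ?d' t2)"
      unfolding fy by linarith
    then show ?thesis
      using that has_caputo_derivative_mittag_leffler_series[OF a b(1) True]
        has_caputo_derivative_mittag_leffler_series[OF a b(2) True] cong unfolding fy by blast
  qed
qed

end

theorem theorem4p1:
  fixes M :: "'a measure"
    and N :: "real \<Rightarrow> real \<Rightarrow> 'a \<Rightarrow> nat"
    and Y :: "nat \<Rightarrow> 'a \<Rightarrow> real"
    and lam \<sigma> \<alpha>2 :: real
  assumes "prob_space M"
    and "lam > 0" and "\<sigma> > 0" and "0 < \<alpha>2" and "\<alpha>2 \<le> 1"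
    and "fractional_poisson_field M lam 1 \<alpha>2 N"
    and "\<And>j. j \<ge> 1 \<Longrightarrow> distributed M lborel (Y j) (exponential_density \<sigma>)"
    and "prob_space.indep_vars M (\<lambda>_. borel) Y {1..}"
    and "prob_space.indep_set M
           (sets (vimage_algebra (space M) (\<lambda>\<omega>. \<lambda>j\<in>{1..}. Y j \<omega>) (PiM {1..} (\<lambda>_. borel))))
           (sets (vimage_algebra (space M) (\<lambda>\<omega>. \<lambda>t\<in>{0..} \<times> {0..}. N (fst t) (snd t) \<omega>)
             (PiM ({0..} \<times> {0..}) (\<lambda>_. count_space UNIV))))"
  shows "(\<forall>y>0. \<forall>t1\<ge>0. \<forall>t2\<ge>0. summable (density_term lam \<sigma> \<alpha>2 y t1 t2)) \<and>
    (\<forall>t1\<ge>0. \<forall>t2\<ge>0. \<forall>y.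
       set_integrable lborel {..y} (\<lambda>x. compound_density lam \<sigma> \<alpha>2 x t1 t2) \<and>
       measure M {\<omega> \<in> space M. compound_field N Y t1 t2 \<omega> \<le> y} =
         mittag_leffler \<alpha>2 1 (- lam * t1 * t2 powr \<alpha>2) * indicator {0..} y
         + (LBINT x:{..y}. compound_density lam \<sigma> \<alpha>2 x t1 t2)) \<and>
    (\<forall>y>0. \<forall>t1\<ge>0. \<forall>t2\<ge>0. \<exists>fy Df Dfy.
       (\<forall>s\<ge>0. ((\<lambda>x. compound_density lam \<sigma> \<alpha>2 x t1 s) has_real_derivative fy s) (at y)) \<and>
       has_caputo_derivative \<alpha>2 (\<lambda>s. compound_density lam \<sigma> \<alpha>2 y t1 s) Df t2 \<and>
       has_caputo_derivative \<alpha>2 fy Dfy t2 \<and>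
       \<sigma> * Df = - (lam * t1 * fy t2 + Dfy)) \<and>
    (\<forall>y>0. \<forall>t1\<ge>0. compound_density lam \<sigma> \<alpha>2 y t1 0 = 0) \<and>
    (\<forall>t1\<ge>0. \<forall>t2\<ge>0.
       set_integrable lborel {0<..} (\<lambda>y. compound_density lam \<sigma> \<alpha>2 y t1 t2) \<and>
       (LBINT y:{0<..}. compound_density lam \<sigma> \<alpha>2 y t1 t2) = 1 - mittag_leffler \<alpha>2 1 (- lam * t1 * t2 powr \<alpha>2))"
proof -
  interpret compound_poisson_field M N Y lam \<sigma> \<alpha>2
    by (rule compound_poisson_field.intro, fact, rule compound_poisson_field_axioms.intro) fact+
  show ?thesis
  proof (intro conjI allI impI)
    show "summable (density_term lam \<sigma> \<alpha>2 y t1 t2)" if "0 < y" "0 \<le> t1" "0 \<le> t2" for y t1 t2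
      by (rule summable_density_term[OF assms(1,2,4-6) that(2,3,1) assms(3)])
    show "\<exists>fy Df Dfy. (\<forall>s\<ge>0. ((\<lambda>x. f x t1 s) has_real_derivative fy s) (at y)) \<and>
        has_caputo_derivative \<alpha>2 (\<lambda>s. f y t1 s) Df t2 \<and> has_caputo_derivative \<alpha>2 fy Dfy t2 \<and>
        \<sigma> * Df = - (lam * t1 * fy t2 + Dfy)" if "0 < y" "0 \<le> t1" "0 \<le> t2" for y t1 t2
    proof (rule compound_density_equation[OF that(2,3,1)])
      fix Df Dfy
      \<comment> \<open>One function of the second time has to be the y-derivative at every s \<ge>
        0, since its Caputo derivative at \<open>t2\<close> depends on its whole past.\<close>
      let ?fy = "mittag_leffler_series \<alpha>2 (\<lambda>k. laguerre_coeff_deriv \<sigma> k y * (lam * t1) ^ k)"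
      assume "has_caputo_derivative \<alpha>2 (\<lambda>s. f y t1 s) Df t2" "has_caputo_derivative \<alpha>2 ?fy Dfy t2"
        "\<sigma> * Df = - (lam * t1 * ?fy t2 + Dfy)"
      moreover have "\<forall>s\<ge>0. ((\<lambda>x. f x t1 s) has_real_derivative ?fy s) (at y)"
        using compound_density_has_real_derivative[OF that(2) _ that(1)] by blast
      ultimately show ?thesis by blast
    qed
    \<comment> \<open>The value at t2 = 0 is the coefficient of index 0, an empty sum.\<close>
    show "f y t1 0 = 0" if "0 < y" "0 \<le> t1" for y t1
      using compound_density_eq_series[OF that(2) _ that(1), of 0]
      by (simp add: mittag_leffler_series_0 laguerre_coeff_def)
  qed (intro compound_field_cdf compound_density_total; assumption)+
qed

end
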